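(* Let $\Omega\subset\mathbb{R}^2$ be a bounded polygonal domain, $f\in[L^2(\Omega)]^2$, $\alpha\in\mathbb{R}$, $\mathcal{T}_h$ a conforming triangulation of $\Omega$, and $k$ a positive integer. Assume the local solvers are well-defined. Consider the hybrid problem: find $(u_h,p_h,\hat u_h)\in V_h\times Q_h\times\hat V_h$ such that, for all $(v_h,q_h,\hat v_h)\in V_h\times Q_h\times\hat V_h$, $$(\nabla\cdot u_h,\nabla\cdot v_h)_{\mathcal{T}_h}+(\nabla\times u_h,\nabla\times v_h)_{\mathcal{T}_h}+\alpha(u_h,v_h)_{\mathcal{T}_h}+\langle\hat p_h,v_h\rangle_{\partial\mathcal{T}_h}=(f,v_h)_{\mathcal{T}_h},$$ $$\langle u_h-\hat u_h,q_h\rangle_{\partial\mathcal{T}_h}=0,\qquad\langle\hat p_h,\hat v_h\rangle_{\partial\mathcal{T}_h}=0,$$ where $\hat p_h=p_h+\gamma(u_h-\hat u_h)$; and the condensed problem: find $\hat u_h\in\hat V_h$ such that, for all $\hat v_h\in\hat V_h$, $$\hat a_h(\hat u_h,\hat v_h)=\langle\hat{\mathsf{P}}f,\hat v_h\rangle_{\partial\mathcal{T}_h}.$$ Then $(u_h,p_h,\hat u_h)\in V_h\times Q_h\times\hat V_h$ is a solution of the hybrid problem if and only if $\hat u_h$ is a solution of the condensed problem with $u_h=\mathsf{U}\hat u_h+\mathsf{U}f$ and $p_h=\mathsf{P}\hat u_h+\mathsf{P}f$. Consequently, the hybrid problem is uniquely solvable if and only if the condensed problem is. In particular, $\hat a_h(\cdot,\cdot)$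 is symmetric positive-definite if $\alpha>0$, and if the complement of $\Omega$ is connected, then this is also true for $\alpha=0$.
   Context: In two dimensions $\nabla\times v=\partial_1v_2-\partial_2v_1$ and $v\times n=v_1n_2-v_2n_1$. $\mathcal{E}_h$ is the set of edges of $\mathcal{T}_h$ and $\mathcal{E}_h^\partial$ the set of boundary edges; $n$ is the outer unit normal. $(\cdot,\cdot)_{\mathcal{T}_h}=\sum_{K\in\mathcal{T}_h}(\cdot,\cdot)_K$ and $\langle\cdot,\cdot\rangle_{\partial\mathcal{T}_h}=\sum_{K\in\mathcal{T}_h}\langle\cdot,\cdot\rangle_{\partial K}$ ($L^2$ inner products). With $P_j$ the polynomials of degree $\le j$, $$V_h=\prod_{K\in\mathcal{T}_h}[P_{2k-1}(K)]^2,\quad Q_h=\prod_{K\in\mathcal{T}_h}\prod_{e\subset\partial K}[P_{k-1}(e)]^2,\quad \hat V_h=\Bigl\{\hat v_h\in\prod_{e\in\mathcal{E}_h}[P_{2k-1}(e)]^2:\hat v_h\times n=0\text{ on }\mathcal{E}_h^\partial\Bigr\}.$$ Elements of $V_h,Q_h$ are generally double-valued on interior edges; in integrals over $K$ or $\partial K$ the value from $K$ is used. Elements of $\hat V_h$ are single-valued. Penalty: let $c_1,\dots,c_L$ be the corners of $\Omega$ with interior angles $\omega_\ell$, and choose $\mu_\ell=1$ if $\omega_\ell\le\pi/2$ and $\mu_\ell<\pi/(2\omega_\ell)$ if $\omega_\ell>\pi/2$. For an edge $e$ with midpoint $m_e$ and length $|e|$, $\Phi_\mu(e)=\prod_{\ell=1}^L|m_e-c_\ell|^{1-\mu_\ell}$,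 and $\gamma|_e=[\Phi_\mu(e)]^2/|e|$. For $K\in\mathcal{T}_h$, $$a_K(u_h,v_h)=(\nabla\cdot u_h,\nabla\cdot v_h)_K+(\nabla\times u_h,\nabla\times v_h)_K+\alpha(u_h,v_h)_K+\langle\gamma u_h,v_h\rangle_{\partial K},\qquad b_K(v_h,q_h)=\langle q_h,v_h\rangle_{\partial K}.$$ Local solvers: for $\hat u_h\in\hat V_h$ and $f\in[L^2(\Omega)]^2$, $(\mathsf{U}\hat u_h,\mathsf{P}\hat u_h)\in V_h\times Q_h$ and $(\mathsf{U}f,\mathsf{P}f)\in V_h\times Q_h$ are the solutions of $$a_K(\mathsf{U}\hat u_h,v_h)+b_K(v_h,\mathsf{P}\hat u_h)=\langle\gamma\hat u_h,v_h\rangle_{\partial K},\qquad b_K(\mathsf{U}\hat u_h,q_h)=\langle\hat u_h,q_h\rangle_{\partial K},$$ $$a_K(\mathsf{U}f,v_h)+b_K(v_h,\mathsf{P}f)=(f,v_h)_K,\qquad b_K(\mathsf{U}f,q_h)=0,$$ for all $K\in\mathcal{T}_h$ and $(v_h,q_h)\in V_h\times Q_h$. The local solvers are called well-defined if these problems are uniquely solvable. Set $\hat{\mathsf{P}}\hat u_h=\mathsf{P}\hat u_h+\gamma(\mathsf{U}\hat u_h-\hat u_h)$, $\hat{\mathsf{P}}f=\mathsf{P}f+\gamma\mathsf{U}f$, and $\hat a_h(\hat u_h,\hat v_h)=-\langle\hat{\mathsf{P}}\hat u_h,\hat v_h\rangle_{\partial\mathcal{T}_h}$. *)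

theory Defs
  imports "HOL-Analysis.Analysis"
begin

type_synonym plane = "real^2"

text \<open>
  Discrete fields are families of functions, so that values on shared edges may differ:
  a cell field is used as \<open>u K x\<close> (cell, point), an edge field as \<open>v e x\<close> (edge, point), and a
  cell-edge field as \<open>q K e x\<close> (cell, edge of that cell, point).
\<close>

type_synonym cell_field = "plane set \<Rightarrow> plane \<Rightarrow> plane"
type_synonym edge_field = "plane set \<Rightarrow> plane \<Rightarrow> plane"
type_synonym cell_edge_field = "plane set \<Rightarrow> plane set \<Rightarrow> plane \<Rightarrow> plane"


section \<open>Polygonal domains, corners and interior angles\<close>

definition sector :: "plane \<Rightarrow> real \<Rightarrow> real \<Rightarrow> real \<Rightarrow> plane set" where
  "sector c r \<theta> \<omega> = {c + \<rho> *\<^sub>R vector [cos t, sin t] | \<rho> t. 0 < \<rho> \<and> \<rho> < r \<and> \<theta> < t \<and> t < \<theta> + \<omega>}"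

definition has_interior_angle :: "plane set \<Rightarrow> plane \<Rightarrow> real \<Rightarrow> bool" where
  "has_interior_angle \<Omega> c \<omega> \<longleftrightarrow>
     0 < \<omega> \<and> \<omega> < 2 * pi \<and> (\<exists>r>0. \<exists>\<theta>. \<Omega> \<inter> ball c r = sector c r \<theta> \<omega>)"

text \<open>
  The boundary is locally that of a sector, the angle being \<open>pi\<close> at non-corner points.  By
  compactness of the frontier there are then finitely many corners and finitely many straight
  sides.  Holes are allowed; slits and pinch points are not.
\<close>

definition polygonal_domain :: "plane set \<Rightarrow> bool" where
  "polygonal_domain \<Omega> \<longleftrightarrow> \<Omega> \<noteq> {} \<and> open \<Omega> \<and> connected \<Omega> \<and> bounded \<Omega> \<and>
     (\<forall>c \<in> frontier \<Omega>. \<exists>\<omega>. has_interior_angle \<Omega> c \<omega>)"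

definition interior_angle :: "plane set \<Rightarrow> plane \<Rightarrow> real" where
  "interior_angle \<Omega> c = (THE \<omega>. has_interior_angle \<Omega> c \<omega>)"

definition corners :: "plane set \<Rightarrow> plane set" where
  "corners \<Omega> = {c \<in> frontier \<Omega>. interior_angle \<Omega> c \<noteq> pi}"

definition admissible_exponents :: "plane set \<Rightarrow> (plane \<Rightarrow> real) \<Rightarrow> bool" where
  "admissible_exponents \<Omega> \<mu> \<longleftrightarrow>
     (\<forall>c \<in> corners \<Omega>.
        (interior_angle \<Omega> c \<le> pi / 2 \<longrightarrow> \<mu> c = 1) \<and>
        (interior_angle \<Omega> c > pi / 2 \<longrightarrow> \<mu> c < pi / (2 * interior_angle \<Omega> c)))"


section \<open>Triangulations and edges\<close>

definition conforming_triangulation :: "plane set \<Rightarrow> plane set set \<Rightarrow> bool" where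
  "conforming_triangulation \<Omega> \<T> \<longleftrightarrow>
     triangulation \<T> \<and> (\<forall>K \<in> \<T>. 2 simplex K) \<and> \<Union>\<T> = closure \<Omega>"

definition mesh_edges :: "plane set set \<Rightarrow> plane set set" where
  "mesh_edges \<T> = {e. \<exists>K \<in> \<T>. e edge_of K}"

definition boundary_edges :: "plane set \<Rightarrow> plane set set \<Rightarrow> plane set set" where
  "boundary_edges \<Omega> \<T> = {e \<in> mesh_edges \<T>. e \<subseteq> frontier \<Omega>}"

text \<open>
  The order of the end points is arbitrary; length, midpoint and edge integral do not depend
  on it.
\<close>

definition edge_ends :: "plane set \<Rightarrow> plane \<times> plane" where
  "edge_ends e = (SOME (a, b). e = closed_segment a b)"

definition edge_length :: "plane set \<Rightarrow> real" where
  "edge_length e = (case edge_ends e of (a, b) \<Rightarrow> dist a b)"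

definition edge_midpoint :: "plane set \<Rightarrow> plane" where
  "edge_midpoint e = (case edge_ends e of (a, b) \<Rightarrow> midpoint a b)"

definition edge_integral :: "plane set \<Rightarrow> (plane \<Rightarrow> real) \<Rightarrow> real" where
  "edge_integral e g =
     (case edge_ends e of (a, b) \<Rightarrow> dist a b * integral {0..1} (\<lambda>t. g (linepath a b t)))"

definition outer_normal :: "plane set \<Rightarrow> plane set \<Rightarrow> plane" where
  "outer_normal K e = (THE n. norm n = 1 \<and> (\<forall>x\<in>e. \<forall>y\<in>e. n \<bullet> (y - x) = 0) \<and>
                              (\<forall>x\<in>e. \<forall>y\<in>K. n \<bullet> (y - x) \<le> 0))"

definition cross2 :: "plane \<Rightarrow> plane \<Rightarrow> real" where
  "cross2 v n = v$1 * n$2 - v$2 * n$1"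

definition corner_weight :: "plane set \<Rightarrow> (plane \<Rightarrow> real) \<Rightarrow> plane set \<Rightarrow> real" where
  "corner_weight \<Omega> \<mu> e = (\<Prod>c \<in> corners \<Omega>. dist (edge_midpoint e) c powr (1 - \<mu> c))"

definition penalty :: "plane set \<Rightarrow> (plane \<Rightarrow> real) \<Rightarrow> plane set \<Rightarrow> real" where
  "penalty \<Omega> \<mu> e = (corner_weight \<Omega> \<mu> e)\<^sup>2 / edge_length e"


section \<open>Discrete spaces\<close>

text \<open>
  Functions on a set are extended by zero and families are zero off their index set, so that
  equality of representatives is equality in the product spaces.
\<close>

definition poly_space :: "nat \<Rightarrow> plane set \<Rightarrow> (plane \<Rightarrow> real) set" where
  "poly_space j S =
     {p. \<exists>c :: nat \<Rightarrow> nat \<Rightarrow> real.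
        p = (\<lambda>x. if x \<in> S then \<Sum>a\<le>j. \<Sum>b\<le>j - a. c a b * (x$1) ^ a * (x$2) ^ b else 0)}"

definition vec_poly_space :: "nat \<Rightarrow> plane set \<Rightarrow> (plane \<Rightarrow> plane) set" where
  "vec_poly_space j S = {v. \<forall>i. (\<lambda>x. v x $ i) \<in> poly_space j S}"

definition V_space :: "plane set set \<Rightarrow> nat \<Rightarrow> cell_field set" where
  "V_space \<T> k =
     {u. \<forall>K. if K \<in> \<T> then u K \<in> vec_poly_space (2 * k - 1) K else u K = (\<lambda>x. 0)}"

definition Q_space :: "plane set set \<Rightarrow> nat \<Rightarrow> cell_edge_field set" where
  "Q_space \<T> k =
     {q. \<forall>K e. if K \<in> \<T> \<and> e edge_of K then q K e \<in> vec_poly_space (k - 1) e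
               else q K e = (\<lambda>x. 0)}"

definition Vhat_space :: "plane set \<Rightarrow> plane set set \<Rightarrow> nat \<Rightarrow> edge_field set" where
  "Vhat_space \<Omega> \<T> k =
     {v. (\<forall>e. if e \<in> mesh_edges \<T> then v e \<in> vec_poly_space (2 * k - 1) e
               else v e = (\<lambda>x. 0)) \<and>
         (\<forall>e \<in> boundary_edges \<Omega> \<T>. \<forall>K \<in> \<T>. e edge_of K \<longrightarrow>
            (\<forall>x \<in> e. cross2 (v e x) (outer_normal K e) = 0))}"

definition L2_fields :: "plane set \<Rightarrow> (plane \<Rightarrow> plane) set" where
  "L2_fields \<Omega> = {f. f \<in> borel_measurable (lebesgue_on \<Omega>) \<and>
                      integrable (lebesgue_on \<Omega>) (\<lambda>x. (norm (f x))\<^sup>2)}"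


section \<open>Bilinear forms\<close>

text \<open>
  A zero-extended polynomial is smooth in the interior of its cell; the values of the partial
  derivatives on the boundary of the cell, a null set, do not matter below.
\<close>

definition partial_deriv :: "2 \<Rightarrow> (plane \<Rightarrow> real) \<Rightarrow> plane \<Rightarrow> real" where
  "partial_deriv i g x = deriv (\<lambda>t. g (x + t *\<^sub>R axis i 1)) 0"

definition div2 :: "(plane \<Rightarrow> plane) \<Rightarrow> plane \<Rightarrow> real" where
  "div2 v x = partial_deriv 1 (\<lambda>y. v y $ 1) x + partial_deriv 2 (\<lambda>y. v y $ 2) x"

definition curl2 :: "(plane \<Rightarrow> plane) \<Rightarrow> plane \<Rightarrow> real" where
  "curl2 v x = partial_deriv 1 (\<lambda>y. v y $ 2) x - partial_deriv 2 (\<lambda>y. v y $ 1) x"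

definition ip_cell :: "plane set \<Rightarrow> (plane \<Rightarrow> 'b::real_inner) \<Rightarrow> (plane \<Rightarrow> 'b) \<Rightarrow> real" where
  "ip_cell K v w = (LINT x:K|lebesgue. v x \<bullet> w x)"

text \<open>The arguments of the form on \<open>\<partial>K\<close> are given edge by edge.\<close>

definition ip_bdry :: "plane set \<Rightarrow> edge_field \<Rightarrow> edge_field \<Rightarrow> real" where
  "ip_bdry K v w = (\<Sum>e | e edge_of K. edge_integral e (\<lambda>x. v e x \<bullet> w e x))"

definition ip_mesh ::
  "plane set set \<Rightarrow> (plane set \<Rightarrow> plane \<Rightarrow> 'b::real_inner) \<Rightarrow> (plane set \<Rightarrow> plane \<Rightarrow> 'b) \<Rightarrow> real" where
  "ip_mesh \<T> v w = (\<Sum>K\<in>\<T>. ip_cell K (v K) (w K))"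

definition ip_mesh_bdry :: "plane set set \<Rightarrow> cell_edge_field \<Rightarrow> cell_edge_field \<Rightarrow> real" where
  "ip_mesh_bdry \<T> v w = (\<Sum>K\<in>\<T>. ip_bdry K (v K) (w K))"

definition a_form ::
  "real \<Rightarrow> (plane set \<Rightarrow> real) \<Rightarrow> plane set \<Rightarrow> cell_field \<Rightarrow> cell_field \<Rightarrow> real" where
  "a_form \<alpha> \<gamma> K u v =
     ip_cell K (div2 (u K)) (div2 (v K)) + ip_cell K (curl2 (u K)) (curl2 (v K))
     + \<alpha> * ip_cell K (u K) (v K) + ip_bdry K (\<lambda>e x. \<gamma> e *\<^sub>R u K x) (\<lambda>e. v K)"

definition b_form :: "plane set \<Rightarrow> cell_field \<Rightarrow> cell_edge_field \<Rightarrow> real" where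
  "b_form K v q = ip_bdry K (q K) (\<lambda>e. v K)"


section \<open>Local solvers\<close>

definition trace_problem ::
  "plane set set \<Rightarrow> nat \<Rightarrow> real \<Rightarrow> (plane set \<Rightarrow> real) \<Rightarrow> edge_field \<Rightarrow>
     cell_field \<times> cell_edge_field \<Rightarrow> bool" where
  "trace_problem \<T> k \<alpha> \<gamma> uh = (\<lambda>(u, p).
     u \<in> V_space \<T> k \<and> p \<in> Q_space \<T> k \<and>
     (\<forall>K \<in> \<T>. \<forall>v \<in> V_space \<T> k. \<forall>q \<in> Q_space \<T> k.
        a_form \<alpha> \<gamma> K u v + b_form K v p = ip_bdry K (\<lambda>e x. \<gamma> e *\<^sub>R uh e x) (\<lambda>e. v K) \<and>
        b_form K u q = ip_bdry K uh (q K)))"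

definition load_problem ::
  "plane set set \<Rightarrow> nat \<Rightarrow> real \<Rightarrow> (plane set \<Rightarrow> real) \<Rightarrow> (plane \<Rightarrow> plane) \<Rightarrow>
     cell_field \<times> cell_edge_field \<Rightarrow> bool" where
  "load_problem \<T> k \<alpha> \<gamma> f = (\<lambda>(u, p).
     u \<in> V_space \<T> k \<and> p \<in> Q_space \<T> k \<and>
     (\<forall>K \<in> \<T>. \<forall>v \<in> V_space \<T> k. \<forall>q \<in> Q_space \<T> k.
        a_form \<alpha> \<gamma> K u v + b_form K v p = ip_cell K f (v K) \<and>
        b_form K u q = 0))"

definition local_solvers_well_defined ::
  "plane set \<Rightarrow> plane set set \<Rightarrow> nat \<Rightarrow> real \<Rightarrow> (plane set \<Rightarrow> real) \<Rightarrow> bool" where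
  "local_solvers_well_defined \<Omega> \<T> k \<alpha> \<gamma> \<longleftrightarrow>
     (\<forall>uh \<in> Vhat_space \<Omega> \<T> k. \<exists>!s. trace_problem \<T> k \<alpha> \<gamma> uh s) \<and>
     (\<forall>f \<in> L2_fields \<Omega>. \<exists>!s. load_problem \<T> k \<alpha> \<gamma> f s)"

definition U_trace ::
  "plane set set \<Rightarrow> nat \<Rightarrow> real \<Rightarrow> (plane set \<Rightarrow> real) \<Rightarrow> edge_field \<Rightarrow> cell_field" where
  "U_trace \<T> k \<alpha> \<gamma> uh = fst (THE s. trace_problem \<T> k \<alpha> \<gamma> uh s)"

definition P_trace ::
  "plane set set \<Rightarrow> nat \<Rightarrow> real \<Rightarrow> (plane set \<Rightarrow> real) \<Rightarrow> edge_field \<Rightarrow> cell_edge_field" where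
  "P_trace \<T> k \<alpha> \<gamma> uh = snd (THE s. trace_problem \<T> k \<alpha> \<gamma> uh s)"

definition U_load ::
  "plane set set \<Rightarrow> nat \<Rightarrow> real \<Rightarrow> (plane set \<Rightarrow> real) \<Rightarrow> (plane \<Rightarrow> plane) \<Rightarrow> cell_field" where
  "U_load \<T> k \<alpha> \<gamma> f = fst (THE s. load_problem \<T> k \<alpha> \<gamma> f s)"

definition P_load ::
  "plane set set \<Rightarrow> nat \<Rightarrow> real \<Rightarrow> (plane set \<Rightarrow> real) \<Rightarrow> (plane \<Rightarrow> plane) \<Rightarrow> cell_edge_field" where
  "P_load \<T> k \<alpha> \<gamma> f = snd (THE s. load_problem \<T> k \<alpha> \<gamma> f s)"

definition Phat_trace ::
  "plane set set \<Rightarrow> nat \<Rightarrow> real \<Rightarrow> (plane set \<Rightarrow> real) \<Rightarrow> edge_field \<Rightarrow> cell_edge_field" where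
  "Phat_trace \<T> k \<alpha> \<gamma> uh = (\<lambda>K e x.
     P_trace \<T> k \<alpha> \<gamma> uh K e x + \<gamma> e *\<^sub>R (U_trace \<T> k \<alpha> \<gamma> uh K x - uh e x))"

definition Phat_load ::
  "plane set set \<Rightarrow> nat \<Rightarrow> real \<Rightarrow> (plane set \<Rightarrow> real) \<Rightarrow> (plane \<Rightarrow> plane) \<Rightarrow> cell_edge_field" where
  "Phat_load \<T> k \<alpha> \<gamma> f = (\<lambda>K e x.
     P_load \<T> k \<alpha> \<gamma> f K e x + \<gamma> e *\<^sub>R U_load \<T> k \<alpha> \<gamma> f K x)"

definition ahat ::
  "plane set set \<Rightarrow> nat \<Rightarrow> real \<Rightarrow> (plane set \<Rightarrow> real) \<Rightarrow> edge_field \<Rightarrow> edge_field \<Rightarrow> real" where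
  "ahat \<T> k \<alpha> \<gamma> uh vh = - ip_mesh_bdry \<T> (Phat_trace \<T> k \<alpha> \<gamma> uh) (\<lambda>K. vh)"


section \<open>The hybrid and condensed problems\<close>

definition hybrid_solution ::
  "plane set \<Rightarrow> plane set set \<Rightarrow> nat \<Rightarrow> real \<Rightarrow> (plane set \<Rightarrow> real) \<Rightarrow> (plane \<Rightarrow> plane) \<Rightarrow>
     cell_field \<times> cell_edge_field \<times> edge_field \<Rightarrow> bool" where
  "hybrid_solution \<Omega> \<T> k \<alpha> \<gamma> f = (\<lambda>(u, p, uh).
     u \<in> V_space \<T> k \<and> p \<in> Q_space \<T> k \<and> uh \<in> Vhat_space \<Omega> \<T> k \<and>
     (let ph = (\<lambda>K e x. p K e x + \<gamma> e *\<^sub>R (u K x - uh e x)) in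
      \<forall>v \<in> V_space \<T> k. \<forall>q \<in> Q_space \<T> k. \<forall>vh \<in> Vhat_space \<Omega> \<T> k.
        ip_mesh \<T> (\<lambda>K. div2 (u K)) (\<lambda>K. div2 (v K))
          + ip_mesh \<T> (\<lambda>K. curl2 (u K)) (\<lambda>K. curl2 (v K))
          + \<alpha> * ip_mesh \<T> u v + ip_mesh_bdry \<T> ph (\<lambda>K e. v K)
          = ip_mesh \<T> (\<lambda>K. f) v \<and>
        ip_mesh_bdry \<T> (\<lambda>K e x. u K x - uh e x) q = 0 \<and>
        ip_mesh_bdry \<T> ph (\<lambda>K. vh) = 0))"

definition condensed_solution ::
  "plane set \<Rightarrow> plane set set \<Rightarrow> nat \<Rightarrow> real \<Rightarrow> (plane set \<Rightarrow> real) \<Rightarrow> (plane \<Rightarrow> plane) \<Rightarrow>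
     edge_field \<Rightarrow> bool" where
  "condensed_solution \<Omega> \<T> k \<alpha> \<gamma> f uh \<longleftrightarrow>
     uh \<in> Vhat_space \<Omega> \<T> k \<and>
     (\<forall>vh \<in> Vhat_space \<Omega> \<T> k.
        ahat \<T> k \<alpha> \<gamma> uh vh = ip_mesh_bdry \<T> (Phat_load \<T> k \<alpha> \<gamma> f) (\<lambda>K. vh))"

definition symmetric_positive_definite_on ::
  "edge_field set \<Rightarrow> (edge_field \<Rightarrow> edge_field \<Rightarrow> real) \<Rightarrow> bool" where
  "symmetric_positive_definite_on V a \<longleftrightarrow>
     (\<forall>v \<in> V. \<forall>w \<in> V. a v w = a w v) \<and> (\<forall>v \<in> V. v \<noteq> (\<lambda>e x. 0) \<longrightarrow> 0 < a v v)"

end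

(*
  The hybrid equations decouple: testing with fields supported on one cell shows that, for a given
  trace, (u, p) solves the cell problems with data (trace, f), hence is the sum of the two local
  solutions by uniqueness; what remains is the condensed equation.

  Inserting the local solutions into each other's equations gives
    ahat(u, v) = sum over K of (div Uu, div Uv) + (curl Uu, curl Uv) + alpha (Uu, Uv)
                 + <gamma (Uu - u), Uv - v>,
  so the form is symmetric and nonnegative.  If it vanishes on v, then Uv = v on the edges; here gamma > 0
  is needed, that is, the midpoint of a mesh edge is not a corner: near it the domain is a half disc or a
  full disc.  For alpha > 0 also Uv = 0.  For alpha = 0 the functions w_1 - i w_2 with w = Uv on a cell are
  restrictions of one entire function F = G'.  Since w is normal to the boundary, Re G is constant on each
  boundary edge, hence on the boundary, which is connected when the complement is.  By the maximum
  principle Re G is constant, so F = 0.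
*)
theory Submission
  imports Defs "HOL-Complex_Analysis.Complex_Analysis"
begin

text \<open>The geometry is given from two unrelated sides: the domain by sectors at its frontier,
  the mesh by \<open>\<Union>\<T> = closure \<Omega>\<close>. Neither says whether an edge runs
  inside the domain, along its frontier or through a corner. This is decided on a small circle
  around a point of the edge, by comparing what the cells cover with the sector of the domain.
  Angles below 2 pi make it work: they leave room outside the closure, so that
  \<open>interior (closure \<Omega>) = \<Omega>\<close>. The second obstacle is that fields are
  extended by zero while integrals and derivatives are total functions. Linearity of the forms holds
  only for controlled arguments, and two regularity classes carry this: continuity up to a null set
  on cells, and continuity on each edge. The cell fields are glued by the single-valued trace: once
  they equal it on the edges, the values from the two sides of an interior edge agree. A common
  vertex gives no such information, whence the care about cells that meet only in a point.\<close>

no_notation fps_nth (infixl "$" 75)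

section \<open>Polynomial fields\<close>

lemma poly_space_add:
  assumes "p \<in> poly_space j S" "q \<in> poly_space j S"
  shows "(\<lambda>x. p x + q x) \<in> poly_space j S"
proof -
  obtain c where c: "p = (\<lambda>x. if x \<in> S then \<Sum>a\<le>j. \<Sum>b\<le>j - a. c a b * (x$1) ^ a * (x$2) ^ b else 0)"
    using assms(1) unfolding poly_space_def by blast
  obtain d where d: "q = (\<lambda>x. if x \<in> S then \<Sum>a\<le>j. \<Sum>b\<le>j - a. d a b * (x$1) ^ a * (x$2) ^ b else 0)"
    using assms(2) unfolding poly_space_def by blast
  show ?thesis
    unfolding poly_space_def c d
    by (rule CollectI, rule exI[of _ "\<lambda>a b. c a b + d a b"])
      (auto simp: fun_eq_iff sum.distrib[symmetric] algebra_simps)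
qed

lemma poly_space_uminus:
  assumes "p \<in> poly_space j S"
  shows "(\<lambda>x. - p x) \<in> poly_space j S"
proof -
  obtain c where c: "p = (\<lambda>x. if x \<in> S then \<Sum>a\<le>j. \<Sum>b\<le>j - a. c a b * (x$1) ^ a * (x$2) ^ b else 0)"
    using assms(1) unfolding poly_space_def by blast
  show ?thesis
    unfolding poly_space_def c
    by (rule CollectI, rule exI[of _ "\<lambda>a b. - c a b"])
      (auto simp: fun_eq_iff sum_negf[symmetric])
qed

lemma poly_space_0: "(\<lambda>x. 0) \<in> poly_space j S"
  unfolding poly_space_def by (rule CollectI, rule exI[of _ "\<lambda>a b. 0"]) auto

lemma vec_poly_space_add:
  "v \<in> vec_poly_space j S \<Longrightarrow> w \<in> vec_poly_space j S \<Longrightarrow> (\<lambda>x. v x + w x) \<in> vec_poly_space j S"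
  unfolding vec_poly_space_def by (auto intro: poly_space_add)

lemma vec_poly_space_diff:
  "v \<in> vec_poly_space j S \<Longrightarrow> w \<in> vec_poly_space j S \<Longrightarrow> (\<lambda>x. v x - w x) \<in> vec_poly_space j S"
  unfolding vec_poly_space_def
  using poly_space_add[OF _ poly_space_uminus, of "\<lambda>x. v x $ i" j S "\<lambda>x. w x $ i" for i] by simp

lemma vec_poly_space_0: "(\<lambda>x. 0) \<in> vec_poly_space j S"
  unfolding vec_poly_space_def by (auto intro: poly_space_0)

lemma vec_poly_space_outside:
  assumes "v \<in> vec_poly_space j S" "x \<notin> S"
  shows "v x = 0"
proof -
  have "v x $ i = 0" for i
  proof -
    have "(\<lambda>x. v x $ i) \<in> poly_space j S"
      using assms(1) unfolding vec_poly_space_def by blast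
    then obtain c where "(\<lambda>x. v x $ i) = (\<lambda>x. if x \<in> S then \<Sum>a\<le>j. \<Sum>b\<le>j - a. c a b * (x$1) ^ a * (x$2) ^ b else 0)"
      unfolding poly_space_def by blast
    from fun_cong[OF this, of x] show ?thesis using assms(2) by simp
  qed
  then show ?thesis by (simp add: vec_eq_iff)
qed

section \<open>Polynomial representatives and their partial derivatives\<close>

lemma real_polynomial_function_nth: "real_polynomial_function (\<lambda>x::plane. x $ i)"
  by (intro real_polynomial_function.intros(1) bounded_linear_vec_nth)

lemma poly_space_polynomial:
  assumes "p \<in> poly_space j S"
  obtains P where "real_polynomial_function P" "\<And>x. x \<in> S \<Longrightarrow> p x = P x"
proof -
  obtain c where c: "p = (\<lambda>x. if x \<in> S then \<Sum>a\<le>j. \<Sum>b\<le>j - a. c a b * (x$1) ^ a * (x$2) ^ b else 0)"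
    using assms(1) unfolding poly_space_def by blast
  show ?thesis
  proof (rule that)
    show "real_polynomial_function (\<lambda>x::plane. \<Sum>a\<le>j. \<Sum>b\<le>j - a. c a b * (x$1) ^ a * (x$2) ^ b)"
      by (intro real_polynomial_function_sum finite_atMost real_polynomial_function.intros(4)
          real_polynomial_function_power real_polynomial_function.intros(2) real_polynomial_function_nth)
  qed (simp add: c)
qed

text \<open>The partial derivatives are wanted as polynomials again, since identities between them
  are later continued from one cell to the whole plane. Linear functions have constant partial
  derivatives, and products follow the product rule.\<close>

lemma real_polynomial_function_gradient:
  fixes P :: "plane \<Rightarrow> real"
  assumes "real_polynomial_function P"
  obtains D :: "2 \<Rightarrow> plane \<Rightarrow> real" where "\<And>i. real_polynomial_function (D i)"
    "\<And>x. (P has_derivative (\<lambda>h. \<Sum>i\<in>UNIV. h $ i * D i x)) (at x)"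
proof -
  have "\<exists>D :: 2 \<Rightarrow> plane \<Rightarrow> real. (\<forall>i. real_polynomial_function (D i)) \<and>
      (\<forall>x. (P has_derivative (\<lambda>h. \<Sum>i\<in>UNIV. h $ i * D i x)) (at x))"
    using assms
  proof induction
    case (linear f)
    then have "linear f" by (simp add: bounded_linear.linear)
    have "f h = (\<Sum>i\<in>UNIV. h $ i * f (axis i 1))" for h
    proof -
      have "f h = f (\<Sum>i\<in>UNIV. h $ i *\<^sub>R axis i 1)"
        by (metis basis_expansion scalar_mult_eq_scaleR)
      also have "\<dots> = (\<Sum>i\<in>UNIV. h $ i * f (axis i 1))"
        by (simp add: linear_sum[OF \<open>linear f\<close>] linear_cmul[OF \<open>linear f\<close>])
      finally show ?thesis .
    qed
    then have "f = (\<lambda>h. \<Sum>i\<in>UNIV. h $ i * f (axis i 1))" by blast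
    moreover have "(f has_derivative f) (at x)" for x
      using linear bounded_linear_imp_has_derivative by blast
    ultimately show ?case
      by (intro exI[of _ "\<lambda>i x. f (axis i 1)"]) (auto intro: real_polynomial_function.intros(2))
  next
    case (const c)
    then show ?case
      by (intro exI[of _ "\<lambda>i x. 0"]) (auto intro: real_polynomial_function.intros(2))
  next
    case (add f g)
    then obtain D E where D: "\<And>i. real_polynomial_function (D i)"
      "\<And>x. (f has_derivative (\<lambda>h. \<Sum>i\<in>UNIV. h $ i * D i x)) (at x)"
      and E: "\<And>i. real_polynomial_function (E i)"
      "\<And>x. (g has_derivative (\<lambda>h. \<Sum>i\<in>UNIV. h $ i * E i x)) (at x)" by blast
    have "((\<lambda>x. f x + g x) has_derivative (\<lambda>h. \<Sum>i\<in>UNIV. h $ i * (D i x + E i x))) (at x)" for x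
      using has_derivative_add[OF D(2)[of x] E(2)[of x]]
      by (simp add: sum.distrib[symmetric] algebra_simps)
    then show ?case
      using D(1) E(1)
      by (intro exI[of _ "\<lambda>i x. D i x + E i x"]) (auto intro: real_polynomial_function.intros(3))
  next
    case (mult f g)
    then obtain D E where D: "\<And>i. real_polynomial_function (D i)"
      "\<And>x. (f has_derivative (\<lambda>h. \<Sum>i\<in>UNIV. h $ i * D i x)) (at x)"
      and E: "\<And>i. real_polynomial_function (E i)"
      "\<And>x. (g has_derivative (\<lambda>h. \<Sum>i\<in>UNIV. h $ i * E i x)) (at x)" by blast
    have "((\<lambda>x. f x * g x) has_derivative (\<lambda>h. \<Sum>i\<in>UNIV. h $ i * (f x * E i x + D i x * g x))) (at x)" for x
      using has_derivative_mult[OF D(2)[of x] E(2)[of x]]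
      by (simp add: sum.distrib[symmetric] sum_distrib_left sum_distrib_right algebra_simps)
    moreover have "real_polynomial_function (\<lambda>x. f x * E i x + D i x * g x)" for i
      by (intro real_polynomial_function.intros D(1) E(1) mult(1,2))
    ultimately show ?case
      by (intro exI[of _ "\<lambda>i x. f x * E i x + D i x * g x"]) auto
  qed
  then show ?thesis using that by blast
qed

text \<open>A zero-extended field may jump at the boundary of \<open>S\<close>; \<open>P\<close> is
  a smooth representative on the whole plane, and \<open>D i j\<close> the partial derivative of its
  component \<open>i\<close> in direction \<open>j\<close>.\<close>

definition polynomial_extension ::
  "plane set \<Rightarrow> (plane \<Rightarrow> plane) \<Rightarrow> (plane \<Rightarrow> plane) \<Rightarrow> (2 \<Rightarrow> 2 \<Rightarrow> plane \<Rightarrow> real) \<Rightarrow> bool" where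
  "polynomial_extension S v P D \<longleftrightarrow>
     (\<forall>i. real_polynomial_function (\<lambda>x. P x $ i)) \<and> (\<forall>i j. real_polynomial_function (D i j)) \<and>
     (\<forall>i x. ((\<lambda>x. P x $ i) has_derivative (\<lambda>h. \<Sum>j\<in>UNIV. h $ j * D i j x)) (at x)) \<and>
     (\<forall>x\<in>S. v x = P x)"

lemma polynomial_extensionD:
  assumes "polynomial_extension S v P D"
  shows "real_polynomial_function (\<lambda>x. P x $ i)" "real_polynomial_function (D i j)"
    "((\<lambda>x. P x $ i) has_derivative (\<lambda>h. \<Sum>j\<in>UNIV. h $ j * D i j x)) (at x)"
    "x \<in> S \<Longrightarrow> v x = P x"
  using assms unfolding polynomial_extension_def by auto

lemma vec_poly_space_polynomial_extension:
  assumes "v \<in> vec_poly_space j S"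
  obtains P D where "polynomial_extension S v P D"
proof -
  have "\<exists>P. real_polynomial_function P \<and> (\<forall>x\<in>S. v x $ i = P x)" for i
  proof -
    have "(\<lambda>x. v x $ i) \<in> poly_space j S" using assms by (simp add: vec_poly_space_def)
    then show ?thesis by (rule poly_space_polynomial) blast
  qed
  then obtain p where p: "\<And>i. real_polynomial_function (p i) \<and> (\<forall>x\<in>S. v x $ i = p i x)"
    using choice[of "\<lambda>i P. real_polynomial_function P \<and> (\<forall>x\<in>S. v x $ i = P x)"] by blast
  have "\<exists>D. (\<forall>j. real_polynomial_function (D j)) \<and>
      (\<forall>x. (p i has_derivative (\<lambda>h. \<Sum>j\<in>UNIV. h $ j * D j x)) (at x))" for i
  proof -
    have "real_polynomial_function (p i)" using p by blast
    then show ?thesis by (rule real_polynomial_function_gradient) blast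
  qed
  then obtain D where D: "\<And>i. (\<forall>j. real_polynomial_function (D i j)) \<and>
      (\<forall>x. (p i has_derivative (\<lambda>h. \<Sum>j\<in>UNIV. h $ j * D i j x)) (at x))"
    using choice[of "\<lambda>i D. (\<forall>j. real_polynomial_function (D j)) \<and>
      (\<forall>x. (p i has_derivative (\<lambda>h. \<Sum>j\<in>UNIV. h $ j * D j x)) (at x))"] by blast
  show ?thesis
    by (rule that[of "\<lambda>x. \<chi> i. p i x" D]) (auto simp: polynomial_extension_def p D vec_eq_iff)
qed

lemma continuous_on_vec:
  fixes P :: "'a::topological_space \<Rightarrow> plane"
  assumes "\<And>i. continuous_on S (\<lambda>x. P x $ i)"
  shows "continuous_on S P"
  using continuous_on_vec_lambda[of S "\<lambda>i x. P x $ i"] assms by simp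

lemma polynomial_extension_continuous:
  assumes "polynomial_extension S v P D"
  shows "continuous_on T P" "continuous_on T (D i j)"
proof -
  have *: "continuous_on T p" if "real_polynomial_function p" for p :: "plane \<Rightarrow> real"
    using that by (simp add: real_polynomial_function_eq continuous_on_polymonial_function)
  show "continuous_on T P"
    by (rule continuous_on_vec) (rule *[OF polynomial_extensionD(1)[OF assms]])
  show "continuous_on T (D i j)"
    by (rule *[OF polynomial_extensionD(2)[OF assms]])
qed

lemma vec_poly_space_continuous_on:
  assumes "v \<in> vec_poly_space j S" "T \<subseteq> S"
  shows "continuous_on T v"
proof -
  obtain P D where PD: "polynomial_extension S v P D"
    by (rule vec_poly_space_polynomial_extension[OF assms(1)])
  show ?thesis
    by (rule continuous_on_eq[OF polynomial_extension_continuous(1)[OF PD]])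
      (use polynomial_extensionD(4)[OF PD] assms(2) in auto)
qed

text \<open>A short line through an interior point stays in \<open>K\<close>, where \<open>v\<close>
  coincides with \<open>P\<close>; at a boundary point the zero extension can destroy the
  derivative.\<close>

lemma polynomial_extension_partial_deriv:
  assumes PD: "polynomial_extension K v P D" and "x \<in> interior K"
  shows "((\<lambda>t. v (x + t *\<^sub>R axis j 1) $ i) has_real_derivative D i j x) (at 0)"
proof -
  have lin: "((\<lambda>t. x + t *\<^sub>R axis j 1) has_derivative (\<lambda>t. t *\<^sub>R axis j 1)) (at 0)"
    by (auto intro!: derivative_eq_intros)
  have "((\<lambda>t. P (x + t *\<^sub>R axis j 1) $ i) has_derivative (\<lambda>t. \<Sum>k\<in>UNIV. (t *\<^sub>R axis j 1) $ k * D i k x)) (at 0)"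
    using has_derivative_compose[OF lin, of "\<lambda>x. P x $ i" "\<lambda>h. \<Sum>j\<in>UNIV. h $ j * D i j x"]
      polynomial_extensionD(3)[OF PD, of i x] by simp
  moreover have "(\<Sum>k\<in>UNIV. (t *\<^sub>R axis j 1) $ k * D i k x) = D i j x * t" for t
    by (simp add: axis_def if_distrib[of "\<lambda>y. _ * y"] if_distrib[of "\<lambda>y. y * _"] cong: if_cong)
  ultimately have P: "((\<lambda>t. P (x + t *\<^sub>R axis j 1) $ i) has_real_derivative D i j x) (at 0)"
    by (simp add: has_field_derivative_def)
  have "((\<lambda>t. x + t *\<^sub>R axis j 1) \<longlongrightarrow> x + 0 *\<^sub>R axis j 1) (at (0::real))"
    by (intro tendsto_intros)
  then have "eventually (\<lambda>t. x + t *\<^sub>R axis j 1 \<in> interior K) (at (0::real))"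
    using assms(2) by (auto simp: tendsto_def open_interior)
  then have "eventually (\<lambda>t. x + t *\<^sub>R axis j 1 \<in> interior K) (nhds (0::real))"
    using assms(2) by (auto simp: eventually_nhds_conv_at)
  then have "eventually (\<lambda>t. v (x + t *\<^sub>R axis j 1) $ i = P (x + t *\<^sub>R axis j 1) $ i) (nhds 0)"
    by eventually_elim (use polynomial_extensionD(4)[OF PD] interior_subset in fastforce)
  then show ?thesis
    using P DERIV_cong_ev[OF refl _ refl] by fast
qed

lemma polynomial_extension_div_curl:
  assumes "polynomial_extension K v P D" "x \<in> interior K"
  shows "div2 v x = D 1 1 x + D 2 2 x" "curl2 v x = D 2 1 x - D 1 2 x"
  unfolding div2_def curl2_def partial_deriv_def
  using polynomial_extension_partial_deriv[OF assms, THEN DERIV_imp_deriv] by simp_all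

text \<open>\<open>partial_deriv\<close> is built on the total operator \<open>deriv\<close>, which
  is additive only where both derivatives exist; hence the restriction to the interior.\<close>

lemma div_curl_diff:
  assumes "v \<in> vec_poly_space d K" "w \<in> vec_poly_space d K" "x \<in> interior K"
  shows "div2 (\<lambda>x. v x - w x) x = div2 v x - div2 w x"
    "curl2 (\<lambda>x. v x - w x) x = curl2 v x - curl2 w x"
proof -
  have *: "((\<lambda>t. v (x + t *\<^sub>R axis j 1) $ i) has_real_derivative partial_deriv j (\<lambda>y. v y $ i) x) (at 0)"
    if v: "v \<in> vec_poly_space d K" for v i j
  proof -
    obtain P D where PD: "polynomial_extension K v P D"
      by (rule vec_poly_space_polynomial_extension[OF v])
    from polynomial_extension_partial_deriv[OF PD assms(3), of j i]
    show ?thesis by (simp add: partial_deriv_def DERIV_imp_deriv)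
  qed
  have "partial_deriv j (\<lambda>y. (v y - w y) $ i) x = partial_deriv j (\<lambda>y. v y $ i) x - partial_deriv j (\<lambda>y. w y $ i) x"
    for i j
    unfolding partial_deriv_def[of _ "\<lambda>y. (v y - w y) $ i"]
    using DERIV_diff[OF *[OF assms(1), of j i] *[OF assms(2), of j i]]
    by (simp_all add: DERIV_imp_deriv)
  then show "div2 (\<lambda>x. v x - w x) x = div2 v x - div2 w x"
    "curl2 (\<lambda>x. v x - w x) x = curl2 v x - curl2 w x"
    by (simp_all add: div2_def curl2_def)
qed

text \<open>On the line from \<open>x0\<close> to \<open>y\<close> the function is a univariate
  polynomial in the parameter. It vanishes for all small parameters, so it is zero, and parameter 1
  gives \<open>y\<close>.\<close>

lemma real_polynomial_function_eq_0:
  fixes P :: "'a::real_normed_vector \<Rightarrow> real"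
  assumes "real_polynomial_function P" "open U" "x0 \<in> U" "\<And>x. x \<in> U \<Longrightarrow> P x = 0"
  shows "P y = 0"
proof -
  have "\<exists>q. \<forall>t. P (x0 + t *\<^sub>R (y - x0)) = poly q t"
    using assms(1)
  proof induction
    case (linear f)
    then have "linear f" by (rule bounded_linear.linear)
    then have "f (x0 + t *\<^sub>R (y - x0)) = poly [:f x0, f (y - x0):] t" for t
      using linear_add[of f x0 "t *\<^sub>R (y - x0)"] linear_cmul[of f t "y - x0"] by simp
    then show ?case by blast
  next
    case (const c)
    then show ?case by (intro exI[of _ "[:c:]"]) simp
  next
    case (add f g)
    then obtain p q where "\<And>t. f (x0 + t *\<^sub>R (y - x0)) = poly p t" "\<And>t. g (x0 + t *\<^sub>R (y - x0)) = poly q t"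
      by blast
    then show ?case by (intro exI[of _ "p + q"]) simp
  next
    case (mult f g)
    then obtain p q where "\<And>t. f (x0 + t *\<^sub>R (y - x0)) = poly p t" "\<And>t. g (x0 + t *\<^sub>R (y - x0)) = poly q t"
      by blast
    then show ?case by (intro exI[of _ "p * q"]) simp
  qed
  then obtain q where q: "\<And>t. P (x0 + t *\<^sub>R (y - x0)) = poly q t" by blast
  have "((\<lambda>t. x0 + t *\<^sub>R (y - x0)) \<longlongrightarrow> x0 + 0 *\<^sub>R (y - x0)) (at (0::real))"
    by (intro tendsto_intros)
  then have "eventually (\<lambda>t. x0 + t *\<^sub>R (y - x0) \<in> U) (at (0::real))"
    using assms(2,3) by (auto simp: tendsto_def)
  then obtain r where r: "r > 0" "\<And>t. t \<noteq> 0 \<Longrightarrow> dist t 0 < r \<Longrightarrow> x0 + t *\<^sub>R (y - x0) \<in> U"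
    unfolding eventually_at by auto
  have "{0<..<r} \<subseteq> {t. poly q t = 0}"
  proof
    fix t assume "t \<in> {0<..<r}"
    then have "x0 + t *\<^sub>R (y - x0) \<in> U" using r(2)[of t] by (simp add: dist_real_def)
    then show "t \<in> {t. poly q t = 0}" using assms(4) q[of t] by auto
  qed
  then have "infinite {t. poly q t = 0}"
    using infinite_super infinite_Ioo[OF r(1)] by blast
  then have "q = 0" using poly_roots_finite by blast
  then show ?thesis using q[of 1] by simp
qed

section \<open>Integrals over cells\<close>

text \<open>Divergence and curl of a zero-extended field have uncontrolled values on the boundary of
  the cell. This class forgets them, while \<open>G\<close>, continuous on the whole plane,
  guarantees integrability over a compact convex cell.\<close>

definition interior_continuous :: "plane set \<Rightarrow> (plane \<Rightarrow> 'b::topological_space) \<Rightarrow> bool" where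
  "interior_continuous K g \<longleftrightarrow> (\<exists>G. continuous_on UNIV G \<and> (\<forall>x\<in>interior K. g x = G x))"

lemma interior_continuous_diff:
  fixes g h :: "plane \<Rightarrow> 'b::real_normed_vector"
  assumes "interior_continuous K g" "interior_continuous K h"
  shows "interior_continuous K (\<lambda>x. g x - h x)"
proof -
  obtain G H where "continuous_on UNIV G" "\<forall>x\<in>interior K. g x = G x"
    "continuous_on UNIV H" "\<forall>x\<in>interior K. h x = H x"
    using assms unfolding interior_continuous_def by blast
  then show ?thesis
    unfolding interior_continuous_def
    by (intro exI[of _ "\<lambda>x. G x - H x"]) (auto intro!: continuous_intros)
qed

lemma interior_continuous_inner:
  fixes g h :: "plane \<Rightarrow> 'b::real_inner"
  assumes "interior_continuous K g" "interior_continuous K h"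
  shows "interior_continuous K (\<lambda>x. g x \<bullet> h x)"
proof -
  obtain G H where "continuous_on UNIV G" "\<forall>x\<in>interior K. g x = G x"
    "continuous_on UNIV H" "\<forall>x\<in>interior K. h x = H x"
    using assms unfolding interior_continuous_def by blast
  then show ?thesis
    unfolding interior_continuous_def
    by (intro exI[of _ "\<lambda>x. G x \<bullet> H x"]) (auto intro!: continuous_intros)
qed

lemma interior_continuous_vec_poly:
  assumes "v \<in> vec_poly_space d K"
  shows "interior_continuous K v" "interior_continuous K (div2 v)" "interior_continuous K (curl2 v)"
proof -
  obtain P D where PD: "polynomial_extension K v P D"
    by (rule vec_poly_space_polynomial_extension[OF assms])
  note cont = polynomial_extension_continuous[OF PD]
  show "interior_continuous K v"
    unfolding interior_continuous_def
    using cont(1) polynomial_extensionD(4)[OF PD] interior_subset by blast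
  show "interior_continuous K (div2 v)"
    unfolding interior_continuous_def
    by (intro exI[of _ "\<lambda>x. D 1 1 x + D 2 2 x"] conjI ballI continuous_on_add cont
        polynomial_extension_div_curl(1)[OF PD])
  show "interior_continuous K (curl2 v)"
    unfolding interior_continuous_def
    by (intro exI[of _ "\<lambda>x. D 2 1 x - D 1 2 x"] conjI ballI continuous_on_diff cont
        polynomial_extension_div_curl(2)[OF PD])
qed

lemma AE_interior_convex:
  fixes K :: "plane set"
  assumes "convex K"
  shows "AE x in lebesgue. x \<in> K \<longrightarrow> x \<in> interior K"
proof -
  have "frontier K \<in> null_sets lebesgue"
    using negligible_convex_frontier[OF assms] by (simp add: negligible_iff_null_sets)
  then have "AE x in lebesgue. x \<notin> frontier K" by (rule AE_not_in)
  then show ?thesis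
    by eventually_elim (auto simp: frontier_def closure_subset[THEN subsetD])
qed

text \<open>\<open>G\<close> is integrable on the compact cell, and \<open>g\<close> can differ from
  it there only on the frontier of \<open>K\<close>, which is negligible by convexity.\<close>

lemma interior_continuous_set_integrable:
  fixes g :: "plane \<Rightarrow> real"
  assumes "convex K" "compact K" "interior_continuous K g"
  shows "set_integrable lebesgue K g"
proof -
  obtain G where G: "continuous_on UNIV G" "\<forall>x\<in>interior K. g x = G x"
    using assms(3) unfolding interior_continuous_def by blast
  have "set_integrable lborel K G"
    using borel_integrable_compact[OF assms(2) continuous_on_subset[OF G(1)]]
    unfolding set_integrable_def by (simp add: indicator_scaleR_eq_if)
  then have iG: "set_integrable lebesgue K G"
    using borel_measurable_integrable by (simp add: set_integrable_def integrable_completion)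
  show ?thesis
    using absolutely_integrable_spike[OF iG negligible_convex_frontier[OF assms(1)], of g] G(2) assms(2)
    by (simp add: frontier_def compact_imp_closed)
qed

lemma ip_cell_commute: "ip_cell K v w = ip_cell K w v"
  by (simp add: ip_cell_def inner_commute)

lemma ip_cell_nonneg: "0 \<le> ip_cell K v v"
  unfolding ip_cell_def set_lebesgue_integral_def by (intro Bochner_Integration.integral_nonneg) auto

lemma ip_cell_0: "ip_cell K v (\<lambda>x. 0) = 0"
  by (simp add: ip_cell_def)

lemma ip_cell_cong:
  assumes "convex K" "\<And>x. x \<in> interior K \<Longrightarrow> v x = v' x"
    "set_integrable lebesgue K (\<lambda>x. v x \<bullet> w x)" "set_integrable lebesgue K (\<lambda>x. v' x \<bullet> w x)"
  shows "ip_cell K v w = ip_cell K v' w"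
  unfolding ip_cell_def set_lebesgue_integral_def
proof (rule integral_cong_AE)
  show "AE x in lebesgue. indicator K x *\<^sub>R (v x \<bullet> w x) = indicator K x *\<^sub>R (v' x \<bullet> w x)"
    using AE_interior_convex[OF assms(1)]
    by eventually_elim (use assms(2) in \<open>auto simp: indicator_def\<close>)
qed (use assms(3,4) in \<open>auto simp: set_integrable_def\<close>)

text \<open>\<open>d\<close> is prescribed only in the interior, because divergence and curl of a
  difference are known only there.\<close>

lemma ip_cell_diff_left:
  fixes v v' w d :: "plane \<Rightarrow> 'b::real_inner"
  assumes "convex K" "compact K" "interior_continuous K v" "interior_continuous K v'"
    "interior_continuous K w" "\<And>x. x \<in> interior K \<Longrightarrow> d x = v x - v' x"
  shows "ip_cell K d w = ip_cell K v w - ip_cell K v' w"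
proof -
  have int: "set_integrable lebesgue K (\<lambda>x. g x \<bullet> w x)" if "interior_continuous K g" for g
    using assms(1,2,5) that by (intro interior_continuous_set_integrable interior_continuous_inner)
  have "interior_continuous K (\<lambda>x. v x - v' x)"
    using assms(3,4) by (rule interior_continuous_diff)
  moreover from this have "interior_continuous K d"
    using assms(6) unfolding interior_continuous_def by simp
  ultimately have "ip_cell K d w = ip_cell K (\<lambda>x. v x - v' x) w"
    using assms(1,6) int by (intro ip_cell_cong) auto
  also have "\<dots> = ip_cell K v w - ip_cell K v' w"
    unfolding ip_cell_def inner_diff_left using int assms(3,4) by (intro set_integral_diff)
  finally show ?thesis .
qed

text \<open>The interior points with \<open>G x \<noteq> 0\<close> form an open null set, and
  nonempty open sets are not null.\<close>

lemma ip_cell_self_eq_0: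
  assumes "convex K" "compact K" "interior_continuous K v" "ip_cell K v v = 0" "x \<in> interior K"
  shows "v x = 0"
proof -
  obtain G where G: "continuous_on UNIV G" "\<forall>x\<in>interior K. v x = G x"
    using assms(3) unfolding interior_continuous_def by blast
  have "integrable lebesgue (\<lambda>x. indicator K x *\<^sub>R (v x \<bullet> v x))"
    using interior_continuous_set_integrable[OF assms(1,2) interior_continuous_inner[OF assms(3,3)]]
    by (simp add: set_integrable_def)
  then have "AE x in lebesgue. indicator K x *\<^sub>R (v x \<bullet> v x) = 0"
    using assms(4) integral_nonneg_eq_0_iff_AE[of lebesgue "\<lambda>x. indicator K x *\<^sub>R (v x \<bullet> v x)"]
    by (simp add: ip_cell_def set_lebesgue_integral_def)
  then have "AE x in lebesgue. x \<notin> {x \<in> interior K. G x \<noteq> 0}"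
    by eventually_elim (use G(2) interior_subset in \<open>auto simp: indicator_def split: if_splits\<close>)
  moreover have op: "open {x \<in> interior K. G x \<noteq> 0}"
  proof -
    have "{x \<in> interior K. G x \<noteq> 0} = interior K \<inter> G -` (- {0})" by auto
    then show ?thesis
      using open_vimage[OF open_Compl[OF closed_singleton[of 0]] G(1)] by (simp add: open_Int)
  qed
  ultimately have "{x \<in> interior K. G x \<noteq> 0} \<in> null_sets lebesgue"
    using AE_iff_null_sets[of "{x \<in> interior K. G x \<noteq> 0}" lebesgue] borel_open[OF op] by simp
  then have "{x \<in> interior K. G x \<noteq> 0} = {}"
    using open_not_negligible[OF op] by (auto simp: negligible_iff_null_sets)
  then show ?thesis using assms(5) G(2) by auto
qed

section \<open>Triangles, edges and sectors\<close>

lemma plane_eq_iff: "(x::plane) = y \<longleftrightarrow> x$1 = y$1 \<and> x$2 = y$2"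
  by (simp add: vec_eq_iff forall_2)

lemma cross2_eq_0_imp_parallel:
  assumes "cross2 p q = 0" "p \<noteq> 0"
  obtains t where "q = t *\<^sub>R p"
proof -
  have "p $ 1 \<noteq> 0 \<or> p $ 2 \<noteq> 0" using assms(2) by (auto simp: plane_eq_iff)
  then show ?thesis
  proof
    assume "p $ 1 \<noteq> 0"
    then have "q = (q $ 1 / p $ 1) *\<^sub>R p"
      using assms(1) by (simp add: plane_eq_iff cross2_def field_simps)
    then show ?thesis by (rule that)
  next
    assume "p $ 2 \<noteq> 0"
    then have "q = (q $ 2 / p $ 2) *\<^sub>R p"
      using assms(1) by (simp add: plane_eq_iff cross2_def field_simps)
    then show ?thesis by (rule that)
  qed
qed

lemma collinear_if_cross2_eq_0:
  assumes "cross2 (b - a) (c - a) = 0"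
  shows "collinear {a, b, c}"
proof (cases "b = a")
  case False
  then obtain t where t: "c - a = t *\<^sub>R (b - a)"
    using cross2_eq_0_imp_parallel[OF assms] by auto
  have "collinear {0, b - a, c - a}"
    using t collinear_lemma[of "b - a" "c - a"] by blast
  then have "collinear {b, a, c}"
    using collinear_3[of b a c] by simp
  then show ?thesis by (simp add: insert_commute)
qed (simp add: insert_commute)

text \<open>Faces of the hull of an affinely independent set are hulls of subsets, and the dimension
  of an edge leaves two of the three vertices. The determinant condition expresses affine
  independence in coordinates.\<close>

lemma triangle_edge_vertices:
  assumes "2 simplex K" "e edge_of K"
  obtains a b c where "K = convex hull {a, b, c}" "e = closed_segment a b" "a \<noteq> b"
    "cross2 (b - a) (c - a) \<noteq> 0"
proof -
  obtain C where C: "\<not> affine_dependent C" "int (card C) = 3" "K = convex hull C"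
    using assms(1) unfolding simplex_def by auto
  then have fin: "finite C" by (metis card.infinite int_ops(1) zero_neq_numeral)
  obtain C' where C': "C' \<subseteq> C" "e = convex hull C'"
    using assms(2) C unfolding edge_of_def by (metis face_of_convex_hull_affine_independent)
  then have "\<not> affine_dependent C'" using C(1) affine_dependent_subset by blast
  then have "card C' = 2"
    using aff_dim_affine_independent[of C'] assms(2) C'(2) by (auto simp: edge_of_def aff_dim_convex_hull)
  then obtain a b where ab: "C' = {a, b}" "a \<noteq> b" by (auto simp: card_2_iff)
  then have "card (C - {a, b}) = 1" using C'(1) C(2) fin by (simp add: card_Diff_subset)
  then obtain c where c: "C - {a, b} = {c}" by (auto simp: card_1_singleton_iff)
  then have Cabc: "C = {a, b, c}" "c \<noteq> a" "c \<noteq> b" using C'(1) ab(1) by auto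
  show ?thesis
  proof
    show "cross2 (b - a) (c - a) \<noteq> 0"
      using collinear_if_cross2_eq_0[of b a c] collinear_3_eq_affine_dependent[of a b c] ab(2) Cabc C(1) by auto
  qed (use C C' Cabc ab in \<open>auto simp: segment_convex_hull\<close>)
qed

text \<open>A segment determines its end points up to order, so the edge may be given by any pair of
  end points, such as the one chosen by \<open>edge_ends\<close>.\<close>

lemma edge_vertices:
  assumes "2 simplex K" "e edge_of K" "e = closed_segment a b"
  obtains c where "K = convex hull {a, b, c}" "a \<noteq> b" "cross2 (b - a) (c - a) \<noteq> 0"
proof -
  obtain a' b' c where c: "K = convex hull {a', b', c}" "e = closed_segment a' b'" "a' \<noteq> b'"
    "cross2 (b' - a') (c - a') \<noteq> 0"
    using triangle_edge_vertices[OF assms(1,2)] by blast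
  then have "{a, b} = {a', b'}" using assms(3) by simp
  then consider "a = a'" "b = b'" | "a = b'" "b = a'" by (auto simp: doubleton_eq_iff)
  then show ?thesis
  proof cases
    case 1
    then show ?thesis using that c by blast
  next
    case 2
    have "cross2 (b - a) (c - a) \<noteq> 0"
      using c(4) 2 by (simp add: cross2_def algebra_simps)
    then show ?thesis using that[of c] c 2 by (simp add: insert_commute)
  qed
qed

lemma finite_edges: "2 simplex K \<Longrightarrow> finite {e. e edge_of K}"
  using finite_polytope_faces[OF simplex_imp_polytope] finite_subset
  unfolding edge_of_def by (metis (mono_tags, lifting) Collect_mono)

lemma triangle_face_cases:
  assumes "2 simplex K" "F face_of K" "x \<in> F"
  shows "F = K \<or> F edge_of K \<or> F = {x} \<and> {x} face_of K"
proof -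
  obtain C where C: "\<not> affine_dependent C" "int (card C) = 3" "K = convex hull C"
    using assms(1) unfolding simplex_def by auto
  then have fin: "finite C" by (metis card.infinite int_ops(1) zero_neq_numeral)
  obtain C' where C': "C' \<subseteq> C" "F = convex hull C'"
    using assms(2) C by (metis face_of_convex_hull_affine_independent)
  then have ind: "\<not> affine_dependent C'" using C(1) affine_dependent_subset by blast
  have fin': "finite C'" using C' fin finite_subset by blast
  have "card C' \<le> 3" using card_mono[OF fin C'(1)] C(2) by simp
  moreover have "card C' \<noteq> 0" using C' assms(3) fin' by auto
  ultimately consider "card C' = 1" | "card C' = 2" | "card C' = 3" by linarith
  then show ?thesis
  proof cases
    case 1
    then obtain z where "C' = {z}" by (auto simp: card_1_singleton_iff)
    then show ?thesis using C'(2) assms(2,3) by simp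
  next
    case 2
    then have "aff_dim F = 1" using aff_dim_affine_independent[OF ind] C'(2) by (simp add: aff_dim_convex_hull)
    then show ?thesis using assms(2) by (simp add: edge_of_def)
  next
    case 3
    then have "C' = C" using card_subset_eq[OF fin C'(1)] C(2) by simp
    then show ?thesis using C C' by simp
  qed
qed

text \<open>A triangle has full dimension, so its topological interior is its relative interior, and
  the rest of a polyhedron is the union of its facets.\<close>

lemma triangle_boundary_in_edge:
  fixes K :: "plane set"
  assumes "2 simplex K" "x \<in> K" "x \<notin> interior K"
  obtains e where "e edge_of K" "x \<in> e"
proof -
  have "aff_dim K = int DIM(plane)" using aff_dim_simplex[OF assms(1)] by simp
  then have "x \<notin> rel_interior K" using assms(3) interior_rel_interior_gen[of K] by auto
  then obtain F where F: "F facet_of K" "x \<in> F"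
    using rel_boundary_of_polyhedron[OF simplex_imp_polyhedron[OF assms(1)]] assms(2) by auto
  then have "F edge_of K"
    using aff_dim_simplex[OF assms(1)] by (auto simp: facet_of_def edge_of_def)
  then show ?thesis using that F(2) by blast
qed

lemma continuous_cross2: "continuous_on UNIV (\<lambda>y. cross2 d (y - a))"
  "continuous_on UNIV (\<lambda>y. cross2 (y - a) d)"
  unfolding cross2_def by (intro continuous_intros)+

text \<open>In barycentric coordinates the coefficient of \<open>c\<close> is \<open>cross2 (b - a) (y - a) / cross2 (b - a) (c - a)\<close>;
  near an inner point of the edge \<open>ab\<close> the other two coefficients stay positive.\<close>

lemma triangle_near_edge:
  assumes "cross2 (b - a) (c - a) \<noteq> 0" "x \<in> open_segment a b"
  shows "eventually (\<lambda>y. y \<in> convex hull {a, b, c} \<longleftrightarrow> 0 \<le> cross2 (b - a) (y - a) / cross2 (b - a) (c - a)) (nhds x)"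
proof -
  define D where "D = cross2 (b - a) (c - a)"
  define \<beta> where "\<beta> y = cross2 (y - a) (c - a) / D" for y
  define \<gamma> where "\<gamma> y = cross2 (b - a) (y - a) / D" for y
  have D: "D \<noteq> 0" using assms(1) by (simp add: D_def)
  \<comment> \<open>Cramer's rule in the frame \<open>b - a\<close>, \<open>c - a\<close>.\<close>
  have coord: "a + u *\<^sub>R (b - a) + v *\<^sub>R (c - a) = y \<longleftrightarrow> u = \<beta> y \<and> v = \<gamma> y" for u v y
  proof
    assume "a + u *\<^sub>R (b - a) + v *\<^sub>R (c - a) = y"
    then have "y - a = u *\<^sub>R (b - a) + v *\<^sub>R (c - a)" by (simp add: algebra_simps)
    then have "cross2 (y - a) (c - a) = u * D" "cross2 (b - a) (y - a) = v * D"
      unfolding D_def by (simp_all only: cross2_def vector_add_component vector_scaleR_component)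
        (simp_all add: algebra_simps)
    then show "u = \<beta> y \<and> v = \<gamma> y" using D by (simp add: \<beta>_def \<gamma>_def)
  next
    assume uv: "u = \<beta> y \<and> v = \<gamma> y"
    have "D *\<^sub>R (y - a) = (u * D) *\<^sub>R (b - a) + (v * D) *\<^sub>R (c - a)"
      using D uv by (simp add: \<beta>_def \<gamma>_def plane_eq_iff) (simp add: D_def cross2_def algebra_simps)
    also have "\<dots> = D *\<^sub>R (u *\<^sub>R (b - a) + v *\<^sub>R (c - a))" by (simp add: algebra_simps)
    finally have "y - a = u *\<^sub>R (b - a) + v *\<^sub>R (c - a)" using D by simp
    then show "a + u *\<^sub>R (b - a) + v *\<^sub>R (c - a) = y" by (simp add: algebra_simps)
  qed
  have iff: "y \<in> convex hull {a, b, c} \<longleftrightarrow> 0 \<le> \<beta> y \<and> 0 \<le> \<gamma> y \<and> \<beta> y + \<gamma> y \<le> 1" for y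
  proof -
    have "y \<in> convex hull {a, b, c} \<longleftrightarrow> (\<exists>u v. a + u *\<^sub>R (b - a) + v *\<^sub>R (c - a) = y \<and> 0 \<le> u \<and> 0 \<le> v \<and> u + v \<le> 1)"
      unfolding convex_hull_3_alt by blast
    then show ?thesis unfolding coord by blast
  qed
  obtain s where s: "0 < s" "s < 1" "x = (1 - s) *\<^sub>R a + s *\<^sub>R b" "a \<noteq> b"
    using assms(2) by (auto simp: in_segment)
  then have "a + s *\<^sub>R (b - a) + 0 *\<^sub>R (c - a) = x" by (simp add: algebra_simps)
  then have x: "\<beta> x = s" "\<gamma> x = 0" using coord[of s 0 x] by simp_all
  have "continuous_on UNIV \<beta>" "continuous_on UNIV (\<lambda>y. \<beta> y + \<gamma> y)"
    unfolding \<beta>_def \<gamma>_def using D by (auto intro!: continuous_intros continuous_cross2)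
  then have "(\<beta> \<longlongrightarrow> \<beta> x) (nhds x)" "((\<lambda>y. \<beta> y + \<gamma> y) \<longlongrightarrow> \<beta> x + \<gamma> x) (nhds x)"
    by (auto simp: continuous_on_eq_continuous_at isCont_def tendsto_nhds_iff)
  then have "eventually (\<lambda>y. \<beta> y > 0) (nhds x)" "eventually (\<lambda>y. \<beta> y + \<gamma> y < 1) (nhds x)"
    using x s(1,2) by (auto intro: order_tendstoD)
  then show ?thesis
    by eventually_elim (auto simp: iff \<gamma>_def D_def)
qed

lemma cross2_segment: "x \<in> closed_segment a b \<Longrightarrow> cross2 (b - a) (y - x) = cross2 (b - a) (y - a)"
  unfolding in_segment
proof (elim exE conjE)
  fix u assume x: "x = (1 - u) *\<^sub>R a + u *\<^sub>R b"
  show "cross2 (b - a) (y - x) = cross2 (b - a) (y - a)"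
    unfolding x by (simp add: cross2_def algebra_simps)
qed

text \<open>\<open>K \<inter> K'\<close> is a face of \<open>K\<close> that meets the relative
  interior of the edge in \<open>x\<close>, so it contains the whole edge; a face of the common face
  is a face of \<open>K'\<close>.\<close>

lemma common_edge:
  assumes "triangulation \<T>" "K \<in> \<T>" "K' \<in> \<T>" "e edge_of K" "e = closed_segment a b"
    "x \<in> open_segment a b" "x \<in> K'"
  shows "e edge_of K'"
proof -
  have F: "K \<inter> K' face_of K" "K \<inter> K' face_of K'"
    using assms(1-3) unfolding triangulation_def by (blast, metis inf_commute)
  have eK: "e face_of K" "e \<subseteq> K" using assms(4) by (auto simp: edge_of_def face_of_imp_subset)
  have "a \<noteq> b" using assms(6) by auto
  then have "x \<in> rel_interior e" using assms(5,6) by (simp add: rel_interior_closed_segment)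
  moreover have "x \<in> K \<inter> K'" using \<open>x \<in> rel_interior e\<close> assms(7) eK(2) rel_interior_subset by blast
  ultimately have "e \<subseteq> K \<inter> K'" using subset_of_face_of[OF F(1) eK(2)] by blast
  then have "e face_of K \<inter> K'" using eK(1) face_of_subset[of e K "K \<inter> K'"] by blast
  then show ?thesis using F(2) assms(4) face_of_trans by (auto simp: edge_of_def)
qed

text \<open>Near an inner point of a mesh edge, the closed domain is a half disc or a full disc, and the
  same alternative holds all along the edge.\<close>

lemma closure_near_edge:
  assumes "conforming_triangulation \<Omega> \<T>" "e \<in> mesh_edges \<T>" "e = closed_segment a b"
  shows "\<exists>P N. (P \<or> N) \<and> (\<forall>x\<in>open_segment a b. eventually (\<lambda>y. y \<in> closure \<Omega> \<longleftrightarrow>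
      P \<and> 0 \<le> cross2 (b - a) (y - x) \<or> N \<and> 0 \<le> cross2 (a - b) (y - x)) (nhds x))"
proof -
  have tri: "triangulation \<T>" and simp2: "\<And>K. K \<in> \<T> \<Longrightarrow> 2 simplex K" and un: "\<Union>\<T> = closure \<Omega>"
    using assms(1) by (auto simp: conforming_triangulation_def)
  have fin: "finite \<T>" using tri by (simp add: triangulation_def)
  obtain K0 where K0: "K0 \<in> \<T>" "e edge_of K0" using assms(2) by (auto simp: mesh_edges_def)
  \<comment> \<open>The sign tells on which side of the edge a cell lies; a cell without this edge
    has neither property. No point of the edge occurs in them, which yields one alternative for the
    entire edge.\<close>
  define pos where "pos K \<longleftrightarrow> (\<exists>c. K = convex hull {a, b, c} \<and> 0 < cross2 (b - a) (c - a))" for K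
  define neg where "neg K \<longleftrightarrow> (\<exists>c. K = convex hull {a, b, c} \<and> cross2 (b - a) (c - a) < 0)" for K
  have near: "eventually (\<lambda>y. y \<in> K \<longleftrightarrow> pos K \<and> 0 \<le> cross2 (b - a) (y - a) \<or> neg K \<and> cross2 (b - a) (y - a) \<le> 0) (nhds x)"
    if K: "K \<in> \<T>" and x: "x \<in> open_segment a b" for K x
  proof (cases "x \<in> K")
    case True
    then have "e edge_of K" using common_edge[OF tri K0(1) K K0(2) assms(3) x] by blast
    then obtain c where c: "K = convex hull {a, b, c}" "a \<noteq> b" "cross2 (b - a) (c - a) \<noteq> 0"
      using edge_vertices[OF simp2[OF K] _ assms(3)] by blast
    have ev: "eventually (\<lambda>y. y \<in> K \<longleftrightarrow> 0 \<le> cross2 (b - a) (y - a) / cross2 (b - a) (c - a)) (nhds x)"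
      using triangle_near_edge[OF c(3) x] c(1) by simp
    \<comment> \<open>The third vertex is known only existentially. A second one on the other side
      is impossible, because a closed half plane containing \<open>a\<close>, \<open>b\<close> and
      \<open>c1\<close> contains all of \<open>K\<close>.\<close>
    have excl: "\<not> (pos K \<and> neg K)"
    proof
      assume "pos K \<and> neg K"
      then obtain c1 c2 where c1: "K = convex hull {a, b, c1}" "0 < cross2 (b - a) (c1 - a)"
        and c2: "K = convex hull {a, b, c2}" "cross2 (b - a) (c2 - a) < 0"
        unfolding pos_def neg_def by blast
      have "convex {y. 0 \<le> cross2 (b - a) (y - a)}"
      proof -
        have eq: "{y. 0 \<le> cross2 (b - a) (y - a)} = {y. vector [- (b - a) $ 2, (b - a) $ 1] \<bullet> y \<ge> vector [- (b - a) $ 2, (b - a) $ 1] \<bullet> a}"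
          by (auto simp: cross2_def inner_vec_def sum_2 algebra_simps)
        show ?thesis unfolding eq by (rule convex_halfspace_ge)
      qed
      then have "convex hull {a, b, c1} \<subseteq> {y. 0 \<le> cross2 (b - a) (y - a)}"
        using c1(2) by (intro hull_minimal) (auto simp: cross2_def)
      moreover have "c2 \<in> convex hull {a, b, c1}" using c1(1) c2(1) hull_inc[of c2 "{a, b, c2}" convex] by simp
      ultimately show False using c2(2) by auto
    qed
    show ?thesis
    proof (cases "0 < cross2 (b - a) (c - a)")
      case True
      then have "pos K" "\<not> neg K" using c(1) excl by (auto simp: pos_def)
      from ev show ?thesis
        by eventually_elim (use True \<open>pos K\<close> \<open>\<not> neg K\<close> in \<open>simp add: zero_le_divide_iff\<close>)
    next
      case False
      then have lt: "cross2 (b - a) (c - a) < 0" using c(3) by simp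
      then have "neg K" "\<not> pos K" using c(1) excl by (auto simp: neg_def)
      from ev show ?thesis
        by eventually_elim (use lt \<open>neg K\<close> \<open>\<not> pos K\<close> in \<open>auto simp: zero_le_divide_iff\<close>)
    qed
  next
    case False
    have "x \<in> convex hull {a, b, c}" for c
      using open_closed_segment[OF x] hull_mono[of "{a, b}" "{a, b, c}" convex] by (auto simp: segment_convex_hull)
    then have "\<not> pos K" "\<not> neg K" using False by (auto simp: pos_def neg_def)
    moreover have "eventually (\<lambda>y. y \<in> - K) (nhds x)"
      using False closed_simplex[OF simp2[OF K]] by (intro eventually_nhds_in_open) auto
    ultimately show ?thesis by (simp add: eventually_mono)
  qed
  show ?thesis
  proof (rule exI[of _ "\<exists>K\<in>\<T>. pos K"], rule exI[of _ "\<exists>K\<in>\<T>. neg K"], intro conjI ballI)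
    obtain c where "K0 = convex hull {a, b, c}" "cross2 (b - a) (c - a) \<noteq> 0"
      using edge_vertices[OF simp2[OF K0(1)] K0(2) assms(3)] by blast
    then show "(\<exists>K\<in>\<T>. pos K) \<or> (\<exists>K\<in>\<T>. neg K)"
      using K0(1) unfolding pos_def neg_def by (cases "0 < cross2 (b - a) (c - a)") (auto simp: not_less order_le_less)
  next
    fix x assume x: "x \<in> open_segment a b"
    have eq: "cross2 (b - a) (y - x) = cross2 (b - a) (y - a)" "cross2 (a - b) (y - x) = - cross2 (b - a) (y - a)" for y
      using cross2_segment[OF open_closed_segment[OF x], of y] by (auto simp: cross2_def algebra_simps)
    have "eventually (\<lambda>y. \<forall>K\<in>\<T>. y \<in> K \<longleftrightarrow> pos K \<and> 0 \<le> cross2 (b - a) (y - a) \<or> neg K \<and> cross2 (b - a) (y - a) \<le> 0) (nhds x)"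
      using near[OF _ x] fin by (intro eventually_ball_finite) auto
    then show "eventually (\<lambda>y. y \<in> closure \<Omega> \<longleftrightarrow>
      (\<exists>K\<in>\<T>. pos K) \<and> 0 \<le> cross2 (b - a) (y - x) \<or> (\<exists>K\<in>\<T>. neg K) \<and> 0 \<le> cross2 (a - b) (y - x)) (nhds x)"
      by eventually_elim (unfold un[symmetric] eq, auto)
  qed
qed

section \<open>Sectors in polar coordinates\<close>

abbreviation direction :: "real \<Rightarrow> plane" where
  "direction t \<equiv> vector [cos t, sin t]"

lemma polar_coordinates_unique:
  assumes "\<rho> *\<^sub>R direction t = \<rho>' *\<^sub>R direction t'" "0 < \<rho>" "0 < \<rho>'" "\<bar>t - t'\<bar> < 2 * pi"
  shows "\<rho> = \<rho>'" "t = t'"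
proof -
  have c: "\<rho> * cos t = \<rho>' * cos t'" and s: "\<rho> * sin t = \<rho>' * sin t'"
    using assms(1) by (simp_all add: plane_eq_iff)
  have "\<rho>\<^sup>2 * ((cos t)\<^sup>2 + (sin t)\<^sup>2) = (\<rho> * cos t)\<^sup>2 + (\<rho> * sin t)\<^sup>2"
    by (simp only: power_mult_distrib distrib_left)
  also have "\<dots> = \<rho>'\<^sup>2 * ((cos t')\<^sup>2 + (sin t')\<^sup>2)"
    unfolding c s by (simp only: power_mult_distrib distrib_left)
  finally have "\<rho>\<^sup>2 = \<rho>'\<^sup>2" by simp
  then show eq: "\<rho> = \<rho>'" using assms(2,3) by simp
  obtain n :: int where n: "t = t' + 2 * pi * n"
    using c s eq assms(2) sin_cos_eq_iff[of t t'] by auto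
  then have "2 * pi * \<bar>real_of_int n\<bar> < 2 * pi * 1" using assms(4) by (simp add: abs_mult)
  then have "\<bar>real_of_int n\<bar> < 1" using mult_less_cancel_left_pos[of "2 * pi"] by simp
  then have "n = 0" by linarith
  then show "t = t'" using n by simp
qed

text \<open>Polar coordinates are continuous and, over an angular range of at most 2 pi, injective
  on an open rectangle, so invariance of domain applies.\<close>

lemma open_sector:
  assumes "\<omega> \<le> 2 * pi"
  shows "open (sector c r \<theta> \<omega>)"
proof -
  define f where "f = (\<lambda>p. c + fst p *\<^sub>R direction (snd p))"
  have "sector c r \<theta> \<omega> = f ` ({0<..<r} \<times> {\<theta><..<\<theta> + \<omega>})"
    unfolding sector_def f_def by (auto simp: image_iff Bex_def simp del: add_left_cancel) blast+
  moreover have "open (f ` ({0<..<r} \<times> {\<theta><..<\<theta> + \<omega>}))"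
  proof (rule invariance_of_domain_gen)
    have "continuous_on UNIV (\<lambda>p::real \<times> real. direction (snd p) $ i)" for i
      using exhaust_2[of i] by (elim disjE) (auto intro!: continuous_intros)
    then have "continuous_on UNIV (\<lambda>p::real \<times> real. direction (snd p))"
      by (rule continuous_on_vec)
    then have "continuous_on UNIV f"
      unfolding f_def by (intro continuous_intros)
    then show "continuous_on ({0<..<r} \<times> {\<theta><..<\<theta> + \<omega>}) f"
      by (rule continuous_on_subset) simp
    show "inj_on f ({0<..<r} \<times> {\<theta><..<\<theta> + \<omega>})"
    proof (rule inj_onI)
      fix p q assume pq: "p \<in> {0<..<r} \<times> {\<theta><..<\<theta> + \<omega>}" "q \<in> {0<..<r} \<times> {\<theta><..<\<theta> + \<omega>}" "f p = f q"
      have "fst p *\<^sub>R direction (snd p) = fst q *\<^sub>R direction (snd q)" "0 < fst p" "0 < fst q"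
        "\<bar>snd p - snd q\<bar> < 2 * pi"
        using pq assms by (auto simp: f_def)
      from polar_coordinates_unique[OF this] show "p = q" by (simp add: prod_eq_iff)
    qed
  qed (auto simp: open_Times)
  ultimately show ?thesis by simp
qed

lemma norm_direction: "norm (direction t) = 1"
proof -
  have "direction t \<bullet> direction t = 1"
    by (simp add: inner_vec_def sum_2 power2_eq_square[symmetric])
  then show ?thesis by (simp add: norm_eq_1)
qed

text \<open>The directions beyond the angle \<open>\<omega>\<close> fill an open sector free of
  \<open>\<Omega>\<close>, and an open set that misses \<open>\<Omega>\<close> misses its closure.
  This supplies points outside the closure next to a frontier point.\<close>

lemma complementary_sector:
  assumes "\<Omega> \<inter> ball c r = sector c r \<theta> \<omega>" "0 < \<omega>" "\<omega> < 2 * pi"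
  shows "sector c r (\<theta> + \<omega>) (2 * pi - \<omega>) \<inter> closure \<Omega> = {}"
proof -
  have "sector c r (\<theta> + \<omega>) (2 * pi - \<omega>) \<subseteq> ball c r"
    by (auto simp: sector_def dist_norm norm_direction)
  moreover have "sector c r (\<theta> + \<omega>) (2 * pi - \<omega>) \<inter> sector c r \<theta> \<omega> = {}"
  proof (rule ccontr)
    assume "sector c r (\<theta> + \<omega>) (2 * pi - \<omega>) \<inter> sector c r \<theta> \<omega> \<noteq> {}"
    then obtain \<rho> t \<rho>' t' where "c + \<rho> *\<^sub>R direction t = c + \<rho>' *\<^sub>R direction t'" "0 < \<rho>" "0 < \<rho>'"
      "\<theta> + \<omega> < t" "t < \<theta> + \<omega> + (2 * pi - \<omega>)" "\<theta> < t'" "t' < \<theta> + \<omega>"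
      unfolding sector_def by blast
    then show False using polar_coordinates_unique(2)[of \<rho> t \<rho>' t'] by auto
  qed
  ultimately have "sector c r (\<theta> + \<omega>) (2 * pi - \<omega>) \<inter> \<Omega> = {}"
    using assms(1) by blast
  then show ?thesis using open_sector[of "2 * pi - \<omega>"] assms(2) by (simp add: open_Int_closure_eq_empty)
qed

text \<open>One radius serves all directions, so a property near \<open>x\<close> can be tested on a
  full circle by varying the angle alone.\<close>

lemma eventually_ray:
  assumes "eventually Q (nhds (x::plane))" "0 < r"
  obtains \<rho> where "0 < \<rho>" "\<rho> < r" "\<And>t. Q (x + \<rho> *\<^sub>R direction t)"
proof -
  obtain \<delta> where d: "0 < \<delta>" "\<And>y. dist y x < \<delta> \<Longrightarrow> Q y"
    using assms(1) unfolding eventually_nhds_metric by blast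
  show ?thesis
  proof (rule that)
    show "0 < min \<delta> r / 2" "min \<delta> r / 2 < r" using d(1) assms(2) by auto
    show "Q (x + (min \<delta> r / 2) *\<^sub>R direction t)" for t
      using d(1) assms(2) by (intro d(2)) (auto simp: dist_norm norm_direction)
  qed
qed

text \<open>At a frontier point the angle is less than 2 pi, so the complementary sector is nonempty
  and contains points outside the closure arbitrarily near. A slit would be a
  counterexample.\<close>

lemma interior_closure_polygonal_domain:
  assumes "polygonal_domain \<Omega>"
  shows "interior (closure \<Omega>) = \<Omega>"
proof
  show "\<Omega> \<subseteq> interior (closure \<Omega>)"
    using assms by (simp add: polygonal_domain_def closure_subset interior_maximal)
  show "interior (closure \<Omega>) \<subseteq> \<Omega>"
  proof
    fix x assume x: "x \<in> interior (closure \<Omega>)"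
    show "x \<in> \<Omega>"
    proof (rule ccontr)
      assume "x \<notin> \<Omega>"
      then have "x \<in> frontier \<Omega>"
        using x assms interior_subset by (auto simp: frontier_def polygonal_domain_def interior_open)
      then obtain \<omega> r \<theta> where w: "0 < \<omega>" "\<omega> < 2 * pi" "0 < r" "\<Omega> \<inter> ball x r = sector x r \<theta> \<omega>"
        using assms unfolding polygonal_domain_def has_interior_angle_def by blast
      have "eventually (\<lambda>y. y \<in> interior (closure \<Omega>)) (nhds x)"
        using x by (simp add: eventually_nhds_in_open)
      then obtain \<rho> where \<rho>: "0 < \<rho>" "\<rho> < r" "\<And>t. x + \<rho> *\<^sub>R direction t \<in> interior (closure \<Omega>)"
        using eventually_ray w(3) by blast
      \<comment> \<open>The bisector of the complementary sector.\<close>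
      define t where "t = \<theta> + \<omega> + (2 * pi - \<omega>) / 2"
      have "\<theta> + \<omega> < t" "t < \<theta> + \<omega> + (2 * pi - \<omega>)" using w(2) by (auto simp: t_def field_simps)
      then have "x + \<rho> *\<^sub>R direction t \<in> sector x r (\<theta> + \<omega>) (2 * pi - \<omega>)"
        using \<rho> unfolding sector_def by blast
      then show False using complementary_sector[OF w(4,1,2)] \<rho>(3)[of t] interior_subset by blast
    qed
  qed
qed

text \<open>On a small circle, membership in the closure is decided by the sign of \<open>s\<close>,
  a sine wave that is reversed by a half turn. A sector below pi would leave two antipodal
  directions outside; one above pi would contain antipodal directions throughout an interval,
  forcing \<open>s\<close> to vanish there.\<close>

lemma half_plane_interior_angle:
  assumes "has_interior_angle \<Omega> x \<omega>" "d \<noteq> 0"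
    "eventually (\<lambda>y. y \<in> closure \<Omega> \<longleftrightarrow> 0 \<le> cross2 d (y - x)) (nhds x)"
  shows "\<omega> = pi"
proof -
  obtain r \<theta> where w: "0 < \<omega>" "\<omega> < 2 * pi" "0 < r" "\<Omega> \<inter> ball x r = sector x r \<theta> \<omega>"
    using assms(1) unfolding has_interior_angle_def by blast
  obtain \<rho> where \<rho>: "0 < \<rho>" "\<rho> < r"
    "\<And>t. x + \<rho> *\<^sub>R direction t \<in> closure \<Omega> \<longleftrightarrow> 0 \<le> cross2 d (x + \<rho> *\<^sub>R direction t - x)"
    using eventually_ray[OF assms(3) w(3)] by blast
  define s where "s t = cross2 d (direction t)" for t
  have "cross2 d (x + \<rho> *\<^sub>R direction t - x) = \<rho> * s t" for t
    by (simp add: s_def cross2_def algebra_simps)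
  then have clos: "x + \<rho> *\<^sub>R direction t \<in> closure \<Omega> \<longleftrightarrow> 0 \<le> s t" for t
    using \<rho>(1,3) by (simp add: zero_le_mult_iff)
  have inside: "0 \<le> s t" if "\<theta> < t" "t < \<theta> + \<omega>" for t
  proof -
    have "x + \<rho> *\<^sub>R direction t \<in> sector x r \<theta> \<omega>" using \<rho> that unfolding sector_def by blast
    then show ?thesis using w(4) clos closure_subset by blast
  qed
  have outside: "s t < 0" if "\<theta> + \<omega> < t" "t < \<theta> + 2 * pi" for t
  proof -
    have "x + \<rho> *\<^sub>R direction t \<in> sector x r (\<theta> + \<omega>) (2 * pi - \<omega>)"
      using \<rho> that unfolding sector_def by (smt (verit) mem_Collect_eq)
    then have "x + \<rho> *\<^sub>R direction t \<notin> closure \<Omega>" using complementary_sector[OF w(4,1,2)] by blast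
    then show ?thesis using clos[of t] by simp
  qed
  have antipode: "s (t + pi) = - s t" for t by (simp add: s_def cross2_def)
  show ?thesis
  proof (rule ccontr)
    assume "\<omega> \<noteq> pi"
    then consider "\<omega> < pi" | "pi < \<omega>" by linarith
    then show False
    proof cases
      case 1
      \<comment> \<open>Measured from \<open>\<theta>\<close>, this is halfway between
        \<open>\<omega>\<close> and \<open>pi\<close>; the direction and its antipode both lie
        strictly between \<open>\<omega>\<close> and \<open>2 * pi\<close>.\<close>
      then have "s (\<theta> + (\<omega> + pi) / 2) < 0" "s (\<theta> + (\<omega> + pi) / 2 + pi) < 0"
        using w(1) by (auto intro!: outside simp: field_simps)
      then show False using antipode[of "\<theta> + (\<omega> + pi) / 2"] by simp
    next
      case 2
      have zero: "s t = 0" if "\<theta> < t" "t < \<theta> + (\<omega> - pi)" for t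
        using inside[of t] inside[of "t + pi"] antipode[of t] that pi_gt_zero by linarith
      \<comment> \<open>A third of the excess, so that \<open>\<theta> + a\<close> and
        \<open>\<theta> + a + a\<close> both fall inside the open interval on which \<open>s\<close>
        is zero.\<close>
      define a where "a = (\<omega> - pi) / 3"
      have a: "0 < a" "a < pi" using 2 w(2) by (auto simp: a_def)
      have z: "s (\<theta> + a) = 0" "s (\<theta> + a + a) = 0" using a(1) by (auto intro!: zero simp: a_def)
      \<comment> \<open>The derivative of \<open>s\<close> at \<open>\<theta> + a\<close>. The
        addition theorem recovers it from the second zero; value and derivative at one point
        determine \<open>d\<close>.\<close>
      define g where "g = d $ 1 * cos (\<theta> + a) + d $ 2 * sin (\<theta> + a)"
      have f: "d $ 1 * sin (\<theta> + a) - d $ 2 * cos (\<theta> + a) = 0"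
        using z(1) by (simp add: s_def cross2_def)
      have "s (\<theta> + a + a) = s (\<theta> + a) * cos a + g * sin a"
        unfolding s_def cross2_def g_def vector_2 sin_add[of "\<theta> + a" a] cos_add[of "\<theta> + a" a]
        by (simp only: algebra_simps)
      then have "g * sin a = 0" using z by simp
      then have "g = 0" using a sin_gt_zero[of a] by simp
      have "(d $ 1)\<^sup>2 + (d $ 2)\<^sup>2 = ((d $ 1)\<^sup>2 + (d $ 2)\<^sup>2) * ((sin (\<theta> + a))\<^sup>2 + (cos (\<theta> + a))\<^sup>2)"
        by simp
      also have "\<dots> = (d $ 1 * sin (\<theta> + a) - d $ 2 * cos (\<theta> + a))\<^sup>2 + g\<^sup>2"
        by (simp add: g_def power2_eq_square algebra_simps del: sin_cos_squared_add sin_cos_squared_add2 sin_cos_squared_add3)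
      also have "\<dots> = 0" using f \<open>g = 0\<close> by simp
      finally have "d $ 1 = 0 \<and> d $ 2 = 0" by (simp add: sum_power2_eq_zero_iff)
      then show False using assms(2) by (simp add: plane_eq_iff)
    qed
  qed
qed

text \<open>Cells on both sides fill a neighbourhood, and
  \<open>interior (closure \<Omega>) = \<Omega>\<close> applies. With cells on one side only, the
  half plane makes each point a frontier point of angle pi.\<close>

lemma edge_point_cases:
  assumes "polygonal_domain \<Omega>" "conforming_triangulation \<Omega> \<T>" "e \<in> mesh_edges \<T>" "e = closed_segment a b"
  shows "open_segment a b \<subseteq> \<Omega> \<or> open_segment a b \<subseteq> frontier \<Omega> - corners \<Omega>"
proof -
  obtain P N where PN: "P \<or> N"
    "\<And>x. x \<in> open_segment a b \<Longrightarrow> eventually (\<lambda>y. y \<in> closure \<Omega> \<longleftrightarrow>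
      P \<and> 0 \<le> cross2 (b - a) (y - x) \<or> N \<and> 0 \<le> cross2 (a - b) (y - x)) (nhds x)"
    using closure_near_edge[OF assms(2-4)] by (elim exE conjE) blast
  have neg: "cross2 (a - b) z = - cross2 (b - a) z" for z by (simp add: cross2_def algebra_simps)
  show ?thesis
  proof (cases "P \<and> N")
    case True
    have "x \<in> \<Omega>" if x: "x \<in> open_segment a b" for x
    proof -
      from PN(2)[OF x] have "eventually (\<lambda>y. y \<in> closure \<Omega>) (nhds x)"
        by eventually_elim (use True neg in auto)
      then have "x \<in> interior (closure \<Omega>)" by (auto simp: eventually_nhds interior_def)
      then show ?thesis using interior_closure_polygonal_domain[OF assms(1)] by simp
    qed
    then show ?thesis by blast
  next
    case False
    then obtain d where d: "d = b - a \<or> d = a - b"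
      "\<And>x. x \<in> open_segment a b \<Longrightarrow> eventually (\<lambda>y. y \<in> closure \<Omega> \<longleftrightarrow> 0 \<le> cross2 d (y - x)) (nhds x)"
      using PN by (cases P) auto
    have "x \<in> frontier \<Omega> - corners \<Omega>" if x: "x \<in> open_segment a b" for x
    proof -
      have d0: "d \<noteq> 0" using d(1) x by auto
      have "x \<in> closure \<Omega>" using eventually_nhds_x_imp_x[OF d(2)[OF x]] by (simp add: cross2_def)
      moreover have "x \<notin> \<Omega>"
      proof
        assume "x \<in> \<Omega>"
        then have "eventually (\<lambda>y. y \<in> \<Omega>) (nhds x)"
          using assms(1) by (intro eventually_nhds_in_open) (auto simp: polygonal_domain_def)
        with d(2)[OF x] have "eventually (\<lambda>y. 0 \<le> cross2 d (y - x)) (nhds x)"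
          by eventually_elim (use closure_subset in auto)
        then obtain \<rho> where \<rho>: "0 < \<rho>" "\<And>t. 0 \<le> cross2 d (x + \<rho> *\<^sub>R direction t - x)"
          using eventually_ray[of "\<lambda>y. 0 \<le> cross2 d (y - x)" x 1] by auto
        have "0 \<le> cross2 d (direction t)" for t
          using \<rho>(2)[of t] \<rho>(1) zero_le_mult_iff[of \<rho> "cross2 d (direction t)"]
          by (simp add: cross2_def algebra_simps)
        \<comment> \<open>A neighbourhood of \<open>x\<close> does not fit into a half plane: the
          four axis directions force both coordinates of \<open>d\<close> to vanish.\<close>
        from this[of 0] this[of pi] this[of "pi / 2"] this[of "- (pi / 2)"]
        show False using d0 by (simp add: cross2_def plane_eq_iff)
      qed
      ultimately have fr: "x \<in> frontier \<Omega>"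
        using assms(1) by (simp add: frontier_def polygonal_domain_def interior_open)
      then obtain \<omega> where \<omega>: "has_interior_angle \<Omega> x \<omega>"
        using assms(1) unfolding polygonal_domain_def by blast
      \<comment> \<open>\<open>interior_angle\<close> is a definite description: the domain provides
        one angle, and every angle at \<open>x\<close> equals pi.\<close>
      have "interior_angle \<Omega> x = pi"
        unfolding interior_angle_def
        using \<omega> half_plane_interior_angle[OF _ d0 d(2)[OF x]] by (intro the_equality) metis+
      then show ?thesis using fr by (simp add: corners_def)
    qed
    then show ?thesis by blast
  qed
qed

section \<open>Positivity of the penalty\<close>

lemma edge_ends_eq:
  assumes "e = closed_segment a b"
  obtains a' b' where "edge_ends e = (a', b')" "e = closed_segment a' b'"
proof -
  have "case edge_ends e of (a, b) \<Rightarrow> e = closed_segment a b"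
    unfolding edge_ends_def using assms by (intro someI[of "\<lambda>p. case p of (a, b) \<Rightarrow> e = closed_segment a b" "(a, b)"]) simp
  then show ?thesis using that by (cases "edge_ends e") auto
qed

lemma polygonal_domain_disjoint_frontier: "polygonal_domain \<Omega> \<Longrightarrow> \<Omega> \<inter> frontier \<Omega> = {}"
  by (auto simp: frontier_def polygonal_domain_def interior_open)

text \<open>A factor \<open>dist m c powr s\<close> vanishes only for \<open>m = c\<close>. The
  midpoint lies in the open segment, which is inside the domain, hence off its frontier, or on the
  frontier away from the corners.\<close>

lemma penalty_pos:
  assumes "polygonal_domain \<Omega>" "conforming_triangulation \<Omega> \<T>" "e \<in> mesh_edges \<T>"
  shows "0 < penalty \<Omega> \<mu> e"
proof -
  obtain K where K: "2 simplex K" "e edge_of K"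
    using assms(2,3) by (auto simp: mesh_edges_def conforming_triangulation_def)
  obtain a b where ab: "e = closed_segment a b" "a \<noteq> b"
    using triangle_edge_vertices[OF K] by blast
  obtain a' b' where ends: "edge_ends e = (a', b')" "e = closed_segment a' b'"
    using edge_ends_eq[OF ab(1)] by blast
  then have "a' \<noteq> b'" using ab by (auto simp: doubleton_eq_iff)
  then have m: "midpoint a' b' \<in> open_segment a' b'" by simp
  have "corners \<Omega> \<subseteq> frontier \<Omega>" by (auto simp: corners_def)
  then have "midpoint a' b' \<notin> corners \<Omega>"
    using edge_point_cases[OF assms ends(2)] m polygonal_domain_disjoint_frontier[OF assms(1)] by blast
  then have "edge_midpoint e \<notin> corners \<Omega>" using ends(1) by (simp add: edge_midpoint_def)
  then have "0 < corner_weight \<Omega> \<mu> e"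
    unfolding corner_weight_def by (intro prod_pos) auto
  then show ?thesis
    using ends(1) \<open>a' \<noteq> b'\<close> by (simp add: penalty_def edge_length_def)
qed

section \<open>Integrals over edges\<close>

text \<open>Additivity of the edge integral requires integrable integrands. Continuity edge by edge
  is common to traces, cell fields and cell-edge fields, and it allows jumps at the
  vertices.\<close>

definition edge_continuous :: "plane set \<Rightarrow> edge_field \<Rightarrow> bool" where
  "edge_continuous K v \<longleftrightarrow> (\<forall>e. e edge_of K \<longrightarrow> continuous_on e (v e))"

lemma edge_continuous_add:
  "edge_continuous K v \<Longrightarrow> edge_continuous K w \<Longrightarrow> edge_continuous K (\<lambda>e x. v e x + w e x)"
  unfolding edge_continuous_def by (auto intro: continuous_on_add)

lemma edge_continuous_diff:
  "edge_continuous K v \<Longrightarrow> edge_continuous K w \<Longrightarrow> edge_continuous K (\<lambda>e x. v e x - w e x)"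
  unfolding edge_continuous_def by (auto intro: continuous_on_diff)

lemma edge_continuous_scale:
  "edge_continuous K v \<Longrightarrow> edge_continuous K (\<lambda>e x. c e *\<^sub>R v e x)"
  unfolding edge_continuous_def by (auto intro!: continuous_intros)

lemma edge_ends_segment:
  assumes "2 simplex K" "e edge_of K"
  obtains a b where "edge_ends e = (a, b)" "e = closed_segment a b" "a \<noteq> b"
proof -
  obtain a b where ab: "e = closed_segment a b" "a \<noteq> b"
    using triangle_edge_vertices[OF assms] by blast
  obtain a' b' where ends: "edge_ends e = (a', b')" "e = closed_segment a' b'"
    using edge_ends_eq[OF ab(1)] by blast
  have "a' \<noteq> b'" using ab ends(2) by (auto simp: doubleton_eq_iff)
  then show ?thesis using that ends by blast
qed

lemma continuous_on_along_segment:
  assumes "continuous_on (closed_segment a b) g"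
  shows "continuous_on {0..1} (\<lambda>t. g (linepath a b t))"
  using continuous_on_compose2[OF assms continuous_on_linepath[of "{0..1}" a b]]
  by (simp add: linepath_image_01)

lemma edge_integral_add:
  assumes "2 simplex K" "e edge_of K" "continuous_on e g" "continuous_on e h"
  shows "edge_integral e (\<lambda>x. g x + h x) = edge_integral e g + edge_integral e h"
proof -
  obtain a b where ab: "edge_ends e = (a, b)" "e = closed_segment a b" "a \<noteq> b"
    by (rule edge_ends_segment[OF assms(1,2)])
  note cont = continuous_on_along_segment[of a b, folded ab(2)]
  show ?thesis
    using cont[OF assms(3)] cont[OF assms(4)]
    by (simp add: edge_integral_def ab(1) Henstock_Kurzweil_Integration.integral_add
        integrable_continuous_real algebra_simps)
qed

lemma edge_integral_diff:
  assumes "2 simplex K" "e edge_of K" "continuous_on e g" "continuous_on e h"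
  shows "edge_integral e (\<lambda>x. g x - h x) = edge_integral e g - edge_integral e h"
proof -
  obtain a b where ab: "edge_ends e = (a, b)" "e = closed_segment a b" "a \<noteq> b"
    by (rule edge_ends_segment[OF assms(1,2)])
  note cont = continuous_on_along_segment[of a b, folded ab(2)]
  show ?thesis
    using cont[OF assms(3)] cont[OF assms(4)]
    by (simp add: edge_integral_def ab(1) Henstock_Kurzweil_Integration.integral_diff
        integrable_continuous_real algebra_simps)
qed

lemma edge_integral_0: "edge_integral e (\<lambda>x. 0) = 0"
  by (simp add: edge_integral_def split: prod.split)

lemma edge_integral_nonneg:
  assumes "2 simplex K" "e edge_of K" "\<And>x. x \<in> e \<Longrightarrow> 0 \<le> g x" "continuous_on e g"
  shows "0 \<le> edge_integral e g"
proof -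
  obtain a b where ab: "edge_ends e = (a, b)" "e = closed_segment a b" "a \<noteq> b"
    by (rule edge_ends_segment[OF assms(1,2)])
  note cont = continuous_on_along_segment[of a b, folded ab(2)]
  have "0 \<le> integral {0..1} (\<lambda>t. g (linepath a b t))"
    using cont[OF assms(4)] assms(3) ab(2)
    by (intro Henstock_Kurzweil_Integration.integral_nonneg integrable_continuous_real)
      (auto simp: linepath_in_path)
  then show ?thesis by (simp add: edge_integral_def ab(1))
qed

lemma edge_integral_eq_0:
  assumes "2 simplex K" "e edge_of K" "\<And>x. x \<in> e \<Longrightarrow> 0 \<le> g x" "continuous_on e g"
    "edge_integral e g = 0" "x \<in> e"
  shows "g x = 0"
proof -
  obtain a b where ab: "edge_ends e = (a, b)" "e = closed_segment a b" "a \<noteq> b"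
    by (rule edge_ends_segment[OF assms(1,2)])
  note cont = continuous_on_along_segment[of a b, folded ab(2)]
  have "integral (cbox 0 1) (\<lambda>t. g (linepath a b t)) = 0"
    using assms(5) ab(1,3) by (simp add: edge_integral_def)
  moreover have "continuous_on (cbox 0 1) (\<lambda>t. g (linepath a b t))" using cont[OF assms(4)] by simp
  moreover have "0 \<le> g (linepath a b t)" if "t \<in> cbox 0 1" for t
    using assms(3) ab(2) that by (simp add: linepath_in_path)
  ultimately have "\<forall>t\<in>cbox 0 1. g (linepath a b t) = 0"
    using integral_cbox_eq_0_iff[of "0::real" 1 "\<lambda>t. g (linepath a b t)"] by simp
  moreover obtain t where "t \<in> {0..1}" "x = linepath a b t"
    using assms(6) ab(2) by (auto simp: linepath_image_01[symmetric])
  ultimately show ?thesis by simp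
qed

lemma ip_bdry_commute: "ip_bdry K v w = ip_bdry K w v"
  by (simp add: ip_bdry_def inner_commute)

lemma ip_bdry_scale_commute: "ip_bdry K (\<lambda>e x. c e *\<^sub>R v e x) w = ip_bdry K (\<lambda>e x. c e *\<^sub>R w e x) v"
  by (simp add: ip_bdry_def inner_commute)

lemma ip_bdry_0: "ip_bdry K v (\<lambda>e x. 0) = 0" "ip_bdry K (\<lambda>e x. 0) v = 0"
  by (simp_all add: ip_bdry_def edge_integral_0)

lemma ip_bdry_add:
  assumes "2 simplex K" "edge_continuous K v" "edge_continuous K v'" "edge_continuous K w"
  shows "ip_bdry K (\<lambda>e x. v e x + v' e x) w = ip_bdry K v w + ip_bdry K v' w"
  unfolding ip_bdry_def sum.distrib[symmetric] inner_add_left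
  by (intro sum.cong refl edge_integral_add[OF assms(1)])
    (use assms(2-4) in \<open>auto simp: edge_continuous_def intro!: continuous_on_inner\<close>)

lemma ip_bdry_diff:
  assumes "2 simplex K" "edge_continuous K v" "edge_continuous K v'" "edge_continuous K w"
  shows "ip_bdry K (\<lambda>e x. v e x - v' e x) w = ip_bdry K v w - ip_bdry K v' w"
  unfolding ip_bdry_def sum_subtractf[symmetric] inner_diff_left
  by (intro sum.cong refl edge_integral_diff[OF assms(1)])
    (use assms(2-4) in \<open>auto simp: edge_continuous_def intro!: continuous_on_inner\<close>)

lemma ip_bdry_scale_self_nonneg:
  assumes "2 simplex K" "edge_continuous K v" "\<And>e. e edge_of K \<Longrightarrow> 0 \<le> c e"
  shows "0 \<le> ip_bdry K (\<lambda>e x. c e *\<^sub>R v e x) v"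
  unfolding ip_bdry_def
  by (intro sum_nonneg edge_integral_nonneg[OF assms(1)])
    (use assms(2,3) in \<open>auto simp: edge_continuous_def intro!: continuous_intros\<close>)

lemma ip_bdry_scale_self_eq_0:
  assumes "2 simplex K" "edge_continuous K v" "\<And>e. e edge_of K \<Longrightarrow> 0 < c e"
    "ip_bdry K (\<lambda>e x. c e *\<^sub>R v e x) v = 0" "e edge_of K" "x \<in> e"
  shows "v e x = 0"
proof -
  have cont: "continuous_on e (\<lambda>x. c e *\<^sub>R v e x \<bullet> v e x)" if "e edge_of K" for e
    using assms(2) that by (auto simp: edge_continuous_def intro!: continuous_intros)
  have nonneg: "0 \<le> c e *\<^sub>R v e x \<bullet> v e x" if "e edge_of K" for e x
    using assms(3)[OF that] by simp
  have "\<forall>e\<in>{e. e edge_of K}. edge_integral e (\<lambda>x. c e *\<^sub>R v e x \<bullet> v e x) = 0"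
    using assms(4) finite_edges[OF assms(1)] unfolding ip_bdry_def
    using edge_integral_nonneg[OF assms(1) _ nonneg cont]
    by (subst (asm) sum_nonneg_eq_0_iff) auto
  then have "edge_integral e (\<lambda>x. c e *\<^sub>R v e x \<bullet> v e x) = 0" using assms(5) by blast
  from edge_integral_eq_0[OF assms(1,5) nonneg[OF assms(5)] cont[OF assms(5)] this assms(6)]
  show ?thesis using assms(3)[OF assms(5)] by simp
qed

section \<open>The hybrid and the condensed problem\<close>

lemma V_spaceD: "u \<in> V_space \<T> k \<Longrightarrow> K \<in> \<T> \<Longrightarrow> u K \<in> vec_poly_space (2 * k - 1) K"
  unfolding V_space_def by (auto split: if_splits)

lemma V_space_outside: "u \<in> V_space \<T> k \<Longrightarrow> K \<notin> \<T> \<Longrightarrow> u K = (\<lambda>x. 0)"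
  unfolding V_space_def by (auto split: if_splits)

lemma Q_spaceD: "q \<in> Q_space \<T> k \<Longrightarrow> K \<in> \<T> \<Longrightarrow> e edge_of K \<Longrightarrow> q K e \<in> vec_poly_space (k - 1) e"
  unfolding Q_space_def by (auto split: if_splits)

lemma Q_space_outside: "q \<in> Q_space \<T> k \<Longrightarrow> \<not> (K \<in> \<T> \<and> e edge_of K) \<Longrightarrow> q K e = (\<lambda>x. 0)"
  unfolding Q_space_def by (auto split: if_splits)

lemma V_spaceI:
  "(\<And>K. K \<in> \<T> \<Longrightarrow> u K \<in> vec_poly_space (2 * k - 1) K) \<Longrightarrow> (\<And>K. K \<notin> \<T> \<Longrightarrow> u K = (\<lambda>x. 0)) \<Longrightarrow> u \<in> V_space \<T> k"
  unfolding V_space_def by simp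

lemma Q_spaceI:
  "(\<And>K e. K \<in> \<T> \<Longrightarrow> e edge_of K \<Longrightarrow> q K e \<in> vec_poly_space (k - 1) e) \<Longrightarrow>
   (\<And>K e. \<not> (K \<in> \<T> \<and> e edge_of K) \<Longrightarrow> q K e = (\<lambda>x. 0)) \<Longrightarrow> q \<in> Q_space \<T> k"
  unfolding Q_space_def by simp

lemma V_space_lincomb:
  assumes "u \<in> V_space \<T> k" "u' \<in> V_space \<T> k"
  shows "(\<lambda>K x. u K x + u' K x) \<in> V_space \<T> k" "(\<lambda>K x. u K x - u' K x) \<in> V_space \<T> k"
  by (rule V_spaceI; simp add: V_space_outside[OF assms(1)] V_space_outside[OF assms(2)]
      vec_poly_space_add vec_poly_space_diff V_spaceD[OF assms(1)] V_spaceD[OF assms(2)] del: One_nat_def)+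

lemma Q_space_lincomb:
  assumes "q \<in> Q_space \<T> k" "q' \<in> Q_space \<T> k"
  shows "(\<lambda>K e x. q K e x + q' K e x) \<in> Q_space \<T> k" "(\<lambda>K e x. q K e x - q' K e x) \<in> Q_space \<T> k"
  by (rule Q_spaceI; simp add: Q_space_outside[OF assms(1)] Q_space_outside[OF assms(2)]
      vec_poly_space_add vec_poly_space_diff Q_spaceD[OF assms(1)] Q_spaceD[OF assms(2)] del: One_nat_def)+

lemma V_space_single:
  "u \<in> V_space \<T> k \<Longrightarrow> K \<in> \<T> \<Longrightarrow> (\<lambda>L. if L = K then u K else (\<lambda>x. 0)) \<in> V_space \<T> k"
  by (rule V_spaceI) (auto intro: V_spaceD vec_poly_space_0 simp del: One_nat_def)

lemma Q_space_single:
  "q \<in> Q_space \<T> k \<Longrightarrow> K \<in> \<T> \<Longrightarrow> (\<lambda>L. if L = K then q K else (\<lambda>e x. 0)) \<in> Q_space \<T> k"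
  by (rule Q_spaceI) (auto intro: Q_spaceD Q_space_outside vec_poly_space_0 simp del: One_nat_def)

lemma zero_in_spaces:
  "(\<lambda>K x. 0) \<in> V_space \<T> k" "(\<lambda>K e x. 0) \<in> Q_space \<T> k" "(\<lambda>e x. 0) \<in> Vhat_space \<Omega> \<T> k"
  by (auto simp: V_space_def Q_space_def Vhat_space_def vec_poly_space_0 cross2_def)

lemma V_space_edge_continuous:
  assumes "u \<in> V_space \<T> k" "K \<in> \<T>"
  shows "edge_continuous K (\<lambda>e. u K)"
  unfolding edge_continuous_def
  using vec_poly_space_continuous_on[OF V_spaceD[OF assms]] edge_of_imp_subset by blast

lemma Q_space_edge_continuous:
  assumes "q \<in> Q_space \<T> k" "K \<in> \<T>"
  shows "edge_continuous K (q K)"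
  unfolding edge_continuous_def
  using vec_poly_space_continuous_on[OF Q_spaceD[OF assms]] by blast

lemma Vhat_spaceD:
  assumes "v \<in> Vhat_space \<Omega> \<T> k" "K \<in> \<T>" "e edge_of K"
  shows "v e \<in> vec_poly_space (2 * k - 1) e"
proof -
  have "e \<in> mesh_edges \<T>" using assms(2,3) by (auto simp: mesh_edges_def)
  then show ?thesis using assms(1) by (simp add: Vhat_space_def del: One_nat_def)
qed

lemma Vhat_space_edge_continuous:
  assumes "v \<in> Vhat_space \<Omega> \<T> k" "K \<in> \<T>"
  shows "edge_continuous K v"
  unfolding edge_continuous_def
  using vec_poly_space_continuous_on[OF Vhat_spaceD[OF assms]] by blast

text \<open>\<open>r\<close> is a residual per cell and \<open>z\<close> the zero test value; the
  last hypothesis holds for product spaces. Of linearity, \<open>r K z = 0\<close> suffices.\<close>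

lemma sum_tests_localize:
  fixes r :: "'a \<Rightarrow> 'b \<Rightarrow> real"
  assumes "finite \<T>" "\<And>K. r K z = 0"
    "\<And>v K. v \<in> W \<Longrightarrow> K \<in> \<T> \<Longrightarrow> (\<lambda>L. if L = K then v K else z) \<in> W"
  shows "(\<forall>v\<in>W. (\<Sum>K\<in>\<T>. r K (v K)) = 0) \<longleftrightarrow> (\<forall>K\<in>\<T>. \<forall>v\<in>W. r K (v K) = 0)"
proof (intro iffI ballI)
  fix K v assume sums: "\<forall>v\<in>W. (\<Sum>K\<in>\<T>. r K (v K)) = 0" and K: "K \<in> \<T>" and v: "v \<in> W"
  have "0 = (\<Sum>L\<in>\<T>. r L (if L = K then v K else z))"
    using bspec[OF sums assms(3)[OF v K]] by simp
  also have "\<dots> = (\<Sum>L\<in>\<T>. if L = K then r K (v K) else 0)"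
    by (intro sum.cong refl) (simp add: assms(2))
  also have "\<dots> = r K (v K)" using assms(1) K by simp
  finally show "r K (v K) = 0" by simp
qed simp

section \<open>Linearity of the local forms\<close>

lemma div_curl_0: "div2 (\<lambda>x. 0) = (\<lambda>x. 0)" "curl2 (\<lambda>x. 0) = (\<lambda>x. 0)"
  by (simp_all add: div2_def curl2_def partial_deriv_def fun_eq_iff)

text \<open>\<open>u''\<close> is prescribed only on \<open>K\<close>, so the rule serves both for a
  difference of two fields and for a field such as \<open>Uf f\<close> that is recognised as
  one.\<close>

lemma a_form_diff:
  assumes "2 simplex K" "K \<in> \<T>" "u \<in> V_space \<T> k" "u' \<in> V_space \<T> k" "v \<in> V_space \<T> k"
    "\<And>x. u'' K x = u K x - u' K x"
  shows "a_form \<alpha> \<gamma> K u'' v = a_form \<alpha> \<gamma> K u v - a_form \<alpha> \<gamma> K u' v"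
proof -
  note K = convex_simplex[OF assms(1)] compact_simplex[OF assms(1)]
  note P = V_spaceD[OF assms(3,2)] V_spaceD[OF assms(4,2)] V_spaceD[OF assms(5,2)]
  note ic = interior_continuous_vec_poly[OF P(1)] interior_continuous_vec_poly[OF P(2)] interior_continuous_vec_poly[OF P(3)]
  have u'': "u'' K = (\<lambda>x. u K x - u' K x)" using assms(6) by blast
  have 1: "ip_cell K (div2 (u'' K)) (div2 (v K)) = ip_cell K (div2 (u K)) (div2 (v K)) - ip_cell K (div2 (u' K)) (div2 (v K))"
    unfolding u'' by (rule ip_cell_diff_left[OF K ic(2,5,8)]) (rule div_curl_diff(1)[OF P(1,2)])
  have 2: "ip_cell K (curl2 (u'' K)) (curl2 (v K)) = ip_cell K (curl2 (u K)) (curl2 (v K)) - ip_cell K (curl2 (u' K)) (curl2 (v K))"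
    unfolding u'' by (rule ip_cell_diff_left[OF K ic(3,6,9)]) (rule div_curl_diff(2)[OF P(1,2)])
  have 3: "ip_cell K (u'' K) (v K) = ip_cell K (u K) (v K) - ip_cell K (u' K) (v K)"
    unfolding u'' by (rule ip_cell_diff_left[OF K ic(1,4,7)]) simp
  note ec = V_space_edge_continuous[OF _ assms(2)]
  have 4: "ip_bdry K (\<lambda>e x. \<gamma> e *\<^sub>R u'' K x) (\<lambda>e. v K)
      = ip_bdry K (\<lambda>e x. \<gamma> e *\<^sub>R u K x) (\<lambda>e. v K) - ip_bdry K (\<lambda>e x. \<gamma> e *\<^sub>R u' K x) (\<lambda>e. v K)"
    unfolding u'' scaleR_diff_right
    by (rule ip_bdry_diff[OF assms(1) edge_continuous_scale[OF ec[OF assms(3)]] edge_continuous_scale[OF ec[OF assms(4)]] ec[OF assms(5)]])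
  show ?thesis unfolding a_form_def 1 2 3 4 by (simp add: algebra_simps)
qed

lemma b_form_diff:
  assumes "2 simplex K" "K \<in> \<T>" "u \<in> V_space \<T> k" "u' \<in> V_space \<T> k" "q \<in> Q_space \<T> k"
  shows "b_form K (\<lambda>K x. u K x - u' K x) q = b_form K u q - b_form K u' q"
  unfolding b_form_def ip_bdry_commute[of K "q K"]
  by (rule ip_bdry_diff[OF assms(1)]) (use V_space_edge_continuous Q_space_edge_continuous assms(2-5) in blast)+

lemma b_form_diff_right:
  assumes "2 simplex K" "K \<in> \<T>" "u \<in> V_space \<T> k" "q \<in> Q_space \<T> k" "q' \<in> Q_space \<T> k"
  shows "b_form K u (\<lambda>K e x. q K e x - q' K e x) = b_form K u q - b_form K u q'"
  unfolding b_form_def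
  by (rule ip_bdry_diff[OF assms(1)]) (use V_space_edge_continuous Q_space_edge_continuous assms(2-5) in blast)+

text \<open>Equivalence and symmetry are algebraic, so the weight \<open>\<gamma>\<close> stays
  abstract; its positivity enters with definiteness.\<close>

locale hybridized_method =
  fixes \<Omega> :: "plane set" and \<T> :: "plane set set" and k :: nat and \<alpha> :: real and \<gamma> :: "plane set \<Rightarrow> real"
  assumes conforming: "conforming_triangulation \<Omega> \<T>"
    and well_defined: "local_solvers_well_defined \<Omega> \<T> k \<alpha> \<gamma>"
begin

abbreviation "V \<equiv> V_space \<T> k"
abbreviation "Q \<equiv> Q_space \<T> k"
abbreviation "Vhat \<equiv> Vhat_space \<Omega> \<T> k"
abbreviation "U \<equiv> U_trace \<T> k \<alpha> \<gamma>"
abbreviation "P \<equiv> P_trace \<T> k \<alpha> \<gamma>"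
abbreviation "Uf \<equiv> U_load \<T> k \<alpha> \<gamma>"
abbreviation "Pf \<equiv> P_load \<T> k \<alpha> \<gamma>"

lemma finite_mesh: "finite \<T>" and simplex2: "K \<in> \<T> \<Longrightarrow> 2 simplex K"
  using conforming by (auto simp: conforming_triangulation_def triangulation_def)

lemma trace_solution: "uh \<in> Vhat \<Longrightarrow> trace_problem \<T> k \<alpha> \<gamma> uh (U uh, P uh)"
  using theI'[of "trace_problem \<T> k \<alpha> \<gamma> uh"] well_defined
  by (simp add: local_solvers_well_defined_def U_trace_def P_trace_def)

lemma load_solution: "f \<in> L2_fields \<Omega> \<Longrightarrow> load_problem \<T> k \<alpha> \<gamma> f (Uf f, Pf f)"
  using theI'[of "load_problem \<T> k \<alpha> \<gamma> f"] well_defined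
  by (simp add: local_solvers_well_defined_def U_load_def P_load_def)

lemma load_unique:
  assumes "f \<in> L2_fields \<Omega>" "load_problem \<T> k \<alpha> \<gamma> f (u, p)"
  shows "u = Uf f" "p = Pf f"
proof -
  have "\<exists>!s. load_problem \<T> k \<alpha> \<gamma> f s"
    using assms(1) well_defined by (simp add: local_solvers_well_defined_def)
  then have "(u, p) = (Uf f, Pf f)" using assms(2) load_solution[OF assms(1)] by blast
  then show "u = Uf f" "p = Pf f" by simp_all
qed

text \<open>The problem quantifies jointly over \<open>v\<close> and \<open>q\<close>; as both
  spaces contain zero, the two equations can be extracted separately.\<close>

lemma trace_solutionD:
  assumes "uh \<in> Vhat"
  shows "U uh \<in> V" "P uh \<in> Q"
    "K \<in> \<T> \<Longrightarrow> v \<in> V \<Longrightarrow> a_form \<alpha> \<gamma> K (U uh) v + b_form K v (P uh) = ip_bdry K (\<lambda>e x. \<gamma> e *\<^sub>R uh e x) (\<lambda>e. v K)"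
    "K \<in> \<T> \<Longrightarrow> q \<in> Q \<Longrightarrow> b_form K (U uh) q = ip_bdry K uh (q K)"
  using trace_solution[OF assms] zero_in_spaces(1)[of \<T> k] zero_in_spaces(2)[of \<T> k] unfolding trace_problem_def by blast+

lemma load_solutionD:
  assumes "f \<in> L2_fields \<Omega>"
  shows "Uf f \<in> V" "Pf f \<in> Q"
    "K \<in> \<T> \<Longrightarrow> v \<in> V \<Longrightarrow> a_form \<alpha> \<gamma> K (Uf f) v + b_form K v (Pf f) = ip_cell K f (v K)"
    "K \<in> \<T> \<Longrightarrow> q \<in> Q \<Longrightarrow> b_form K (Uf f) q = 0"
  using load_solution[OF assms] zero_in_spaces(1)[of \<T> k] zero_in_spaces(2)[of \<T> k] unfolding load_problem_def by blast+

section \<open>Decoupling into cell problems\<close>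

definition local_problem where
  "local_problem f uh u p \<longleftrightarrow> u \<in> V \<and> p \<in> Q \<and>
     (\<forall>K\<in>\<T>. \<forall>v\<in>V. a_form \<alpha> \<gamma> K u v + b_form K v p = ip_cell K f (v K) + ip_bdry K (\<lambda>e x. \<gamma> e *\<^sub>R uh e x) (\<lambda>e. v K)) \<and>
     (\<forall>K\<in>\<T>. \<forall>q\<in>Q. b_form K u q = ip_bdry K uh (q K))"

text \<open>Uniqueness is given for either kind of data alone, not for both at once. Subtracting the
  trace solution leaves a load problem, to which it applies.\<close>

lemma local_problem_iff:
  assumes f: "f \<in> L2_fields \<Omega>" and uh: "uh \<in> Vhat"
  shows "local_problem f uh u p \<longleftrightarrow>
    u = (\<lambda>K x. U uh K x + Uf f K x) \<and> p = (\<lambda>K e x. P uh K e x + Pf f K e x)"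
proof
  assume lp: "local_problem f uh u p"
  then have up: "u \<in> V" "p \<in> Q" by (auto simp: local_problem_def)
  note t = trace_solutionD[OF uh]
  have "load_problem \<T> k \<alpha> \<gamma> f (\<lambda>K x. u K x - U uh K x, \<lambda>K e x. p K e x - P uh K e x)"
    unfolding load_problem_def prod.case
  proof (intro conjI ballI)
    show "(\<lambda>K x. u K x - U uh K x) \<in> V" "(\<lambda>K e x. p K e x - P uh K e x) \<in> Q"
      using V_space_lincomb(2)[OF up(1) t(1)] Q_space_lincomb(2)[OF up(2) t(2)] by simp_all
  next
    fix K v q assume K: "K \<in> \<T>" and v: "v \<in> V" and q: "q \<in> Q"
    note S = simplex2[OF K] K
    have "a_form \<alpha> \<gamma> K u v + b_form K v p = ip_cell K f (v K) + ip_bdry K (\<lambda>e x. \<gamma> e *\<^sub>R uh e x) (\<lambda>e. v K)"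
      using lp K v unfolding local_problem_def by blast
    then show "a_form \<alpha> \<gamma> K (\<lambda>K x. u K x - U uh K x) v + b_form K v (\<lambda>K e x. p K e x - P uh K e x) = ip_cell K f (v K)"
      using t(3)[OF K v] by (simp add: a_form_diff[OF S up(1) t(1) v] b_form_diff_right[OF S v up(2) t(2)])
    show "b_form K (\<lambda>K x. u K x - U uh K x) q = 0"
      using lp K q t(4)[OF K q] unfolding local_problem_def
      by (simp add: b_form_diff[OF S up(1) t(1) q])
  qed
  from load_unique[OF f this] show "u = (\<lambda>K x. U uh K x + Uf f K x) \<and> p = (\<lambda>K e x. P uh K e x + Pf f K e x)"
    by (auto simp: fun_eq_iff algebra_simps dest!: sym)
next
  assume up: "u = (\<lambda>K x. U uh K x + Uf f K x) \<and> p = (\<lambda>K e x. P uh K e x + Pf f K e x)"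
  note t = trace_solutionD[OF uh] and l = load_solutionD[OF f]
  have uV: "u \<in> V" and pQ: "p \<in> Q"
    using up V_space_lincomb(1)[OF t(1) l(1)] Q_space_lincomb(1)[OF t(2) l(2)] by simp_all
  \<comment> \<open>The converse also runs through differences: \<open>u\<close> minus
    \<open>U uh\<close> is \<open>Uf f\<close>, so the rules for differences yield
    additivity.\<close>
  have dU: "(\<lambda>K x. u K x - U uh K x) = Uf f" and dP: "(\<lambda>K e x. p K e x - P uh K e x) = Pf f"
    using up by (simp_all add: fun_eq_iff)
  show "local_problem f uh u p"
    unfolding local_problem_def
  proof (intro conjI ballI uV pQ)
    fix K v assume K: "K \<in> \<T>" and v: "v \<in> V"
    note S = simplex2[OF K] K
    show "a_form \<alpha> \<gamma> K u v + b_form K v p = ip_cell K f (v K) + ip_bdry K (\<lambda>e x. \<gamma> e *\<^sub>R uh e x) (\<lambda>e. v K)"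
      using t(3)[OF K v] l(3)[OF K v] a_form_diff[OF S uV t(1) v, of "Uf f"] up
        b_form_diff_right[OF S v pQ t(2)]
      unfolding dP by simp
  next
    fix K q assume K: "K \<in> \<T>" and q: "q \<in> Q"
    show "b_form K u q = ip_bdry K uh (q K)"
      using t(4)[OF K q] l(4)[OF K q] b_form_diff[OF simplex2[OF K] K uV t(1) q] unfolding dU by simp
  qed
qed

lemma flux_split:
  assumes "u \<in> V" "p \<in> Q" "uh \<in> Vhat" "K \<in> \<T>" "edge_continuous K w"
  shows "ip_bdry K (\<lambda>e x. p K e x + \<gamma> e *\<^sub>R (u K x - uh e x)) w
    = ip_bdry K (p K) w + (ip_bdry K (\<lambda>e x. \<gamma> e *\<^sub>R u K x) w - ip_bdry K (\<lambda>e x. \<gamma> e *\<^sub>R uh e x) w)"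
proof -
  note S = simplex2[OF assms(4)]
  note c = V_space_edge_continuous[OF assms(1,4)] Q_space_edge_continuous[OF assms(2,4)] Vhat_space_edge_continuous[OF assms(3,4)]
  have "ip_bdry K (\<lambda>e x. p K e x + \<gamma> e *\<^sub>R (u K x - uh e x)) w
      = ip_bdry K (p K) w + ip_bdry K (\<lambda>e x. \<gamma> e *\<^sub>R (u K x - uh e x)) w"
    by (rule ip_bdry_add[OF S c(2) edge_continuous_scale[OF edge_continuous_diff[OF c(1,3)]] assms(5)])
  also have "ip_bdry K (\<lambda>e x. \<gamma> e *\<^sub>R (u K x - uh e x)) w
      = ip_bdry K (\<lambda>e x. \<gamma> e *\<^sub>R u K x) w - ip_bdry K (\<lambda>e x. \<gamma> e *\<^sub>R uh e x) w"
    unfolding scaleR_diff_right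
    by (rule ip_bdry_diff[OF S edge_continuous_scale[OF c(1)] edge_continuous_scale[OF c(3)] assms(5)])
  finally show ?thesis .
qed

text \<open>\<open>V\<close> and \<open>Q\<close> are products over the cells, so the first two
  equations localize. \<open>Vhat\<close> ties neighbouring cells together, and the third equation
  stays global.\<close>

lemma hybrid_solution_iff_local:
  "hybrid_solution \<Omega> \<T> k \<alpha> \<gamma> f (u, p, uh) \<longleftrightarrow> uh \<in> Vhat \<and> local_problem f uh u p \<and>
     (\<forall>vh\<in>Vhat. ip_mesh_bdry \<T> (\<lambda>K e x. p K e x + \<gamma> e *\<^sub>R (u K x - uh e x)) (\<lambda>K. vh) = 0)"
proof (cases "u \<in> V \<and> p \<in> Q \<and> uh \<in> Vhat")
  case True
  then have u: "u \<in> V" and p: "p \<in> Q" and uh: "uh \<in> Vhat" by auto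
  define ph where "ph = (\<lambda>K e x. p K e x + \<gamma> e *\<^sub>R (u K x - uh e x))"
  \<comment> \<open>The residual of the first equation on one cell, as a function of the test
    function on that cell.\<close>
  define r where "r K w = ip_cell K (div2 (u K)) (div2 w) + ip_cell K (curl2 (u K)) (curl2 w)
      + \<alpha> * ip_cell K (u K) w + ip_bdry K (ph K) (\<lambda>e. w) - ip_cell K f w" for K w
  have r: "r K (v K) = a_form \<alpha> \<gamma> K u v + b_form K v p
      - (ip_cell K f (v K) + ip_bdry K (\<lambda>e x. \<gamma> e *\<^sub>R uh e x) (\<lambda>e. v K))" if "K \<in> \<T>" "v \<in> V" for K v
    using flux_split[OF u p uh that(1) V_space_edge_continuous[OF that(2,1)]]
    by (simp add: r_def ph_def a_form_def b_form_def)
  have "(\<forall>v\<in>V. ip_mesh \<T> (\<lambda>K. div2 (u K)) (\<lambda>K. div2 (v K)) + ip_mesh \<T> (\<lambda>K. curl2 (u K)) (\<lambda>K. curl2 (v K))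
          + \<alpha> * ip_mesh \<T> u v + ip_mesh_bdry \<T> ph (\<lambda>K e. v K) = ip_mesh \<T> (\<lambda>K. f) v)
      \<longleftrightarrow> (\<forall>v\<in>V. (\<Sum>K\<in>\<T>. r K (v K)) = 0)"
    by (simp add: r_def ip_mesh_def ip_mesh_bdry_def sum.distrib sum_subtractf sum_distrib_left)
  also have "\<dots> \<longleftrightarrow> (\<forall>K\<in>\<T>. \<forall>v\<in>V. r K (v K) = 0)"
    by (rule sum_tests_localize[OF finite_mesh, of r "\<lambda>x. 0"])
      (auto simp: r_def div_curl_0 ip_cell_0 ip_bdry_0 V_space_single)
  finally have first: "(\<forall>v\<in>V. ip_mesh \<T> (\<lambda>K. div2 (u K)) (\<lambda>K. div2 (v K)) + ip_mesh \<T> (\<lambda>K. curl2 (u K)) (\<lambda>K. curl2 (v K))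
          + \<alpha> * ip_mesh \<T> u v + ip_mesh_bdry \<T> ph (\<lambda>K e. v K) = ip_mesh \<T> (\<lambda>K. f) v)
      \<longleftrightarrow> (\<forall>K\<in>\<T>. \<forall>v\<in>V. a_form \<alpha> \<gamma> K u v + b_form K v p
         = ip_cell K f (v K) + ip_bdry K (\<lambda>e x. \<gamma> e *\<^sub>R uh e x) (\<lambda>e. v K))"
    by (simp add: r)
  have "(\<forall>q\<in>Q. ip_mesh_bdry \<T> (\<lambda>K e x. u K x - uh e x) q = 0)
      \<longleftrightarrow> (\<forall>K\<in>\<T>. \<forall>q\<in>Q. ip_bdry K (\<lambda>e x. u K x - uh e x) (q K) = 0)"
    unfolding ip_mesh_bdry_def
    by (rule sum_tests_localize[OF finite_mesh, of "\<lambda>K. ip_bdry K (\<lambda>e x. u K x - uh e x)" "\<lambda>e x. 0"])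
      (auto simp: ip_bdry_0 Q_space_single)
  moreover have "ip_bdry K (\<lambda>e x. u K x - uh e x) (q K) = b_form K u q - ip_bdry K uh (q K)"
    if "K \<in> \<T>" "q \<in> Q" for K q
    using ip_bdry_diff[OF simplex2[OF that(1)] V_space_edge_continuous[OF u that(1)]
        Vhat_space_edge_continuous[OF uh that(1)] Q_space_edge_continuous[OF that(2,1)]]
    by (simp add: b_form_def ip_bdry_commute)
  ultimately have second: "(\<forall>q\<in>Q. ip_mesh_bdry \<T> (\<lambda>K e x. u K x - uh e x) q = 0)
      \<longleftrightarrow> (\<forall>K\<in>\<T>. \<forall>q\<in>Q. b_form K u q = ip_bdry K uh (q K))"
    by simp
  \<comment> \<open>The three equations stand under one block of quantifiers; nonempty test spaces
    allow them to be separated.\<close>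
  have ne: "V \<noteq> {}" "Q \<noteq> {}" "Vhat \<noteq> {}" using zero_in_spaces by blast+
  show ?thesis
    unfolding hybrid_solution_def prod.case Let_def ph_def[symmetric] local_problem_def
      first[symmetric] second[symmetric]
    using True ne by blast
next
  case False
  then show ?thesis by (auto simp: hybrid_solution_def local_problem_def)
qed

text \<open>The numerical flux is linear in \<open>(u, p, uh)\<close>, so for superposed local
  solutions it is the sum of \<open>Phat_trace\<close> and \<open>Phat_load\<close>; its vanishing
  against all traces is the condensed equation.\<close>

lemma hybrid_solution_iff_condensed:
  assumes f: "f \<in> L2_fields \<Omega>"
  shows "hybrid_solution \<Omega> \<T> k \<alpha> \<gamma> f (u, p, uh) \<longleftrightarrow> condensed_solution \<Omega> \<T> k \<alpha> \<gamma> f uh \<and>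
     u = (\<lambda>K x. U uh K x + Uf f K x) \<and> p = (\<lambda>K e x. P uh K e x + Pf f K e x)"
proof (cases "uh \<in> Vhat \<and> u = (\<lambda>K x. U uh K x + Uf f K x) \<and> p = (\<lambda>K e x. P uh K e x + Pf f K e x)")
  case True
  then have uh: "uh \<in> Vhat" and up: "u = (\<lambda>K x. U uh K x + Uf f K x)" "p = (\<lambda>K e x. P uh K e x + Pf f K e x)"
    by auto
  note t = trace_solutionD[OF uh] and l = load_solutionD[OF f]
  have flux: "ip_mesh_bdry \<T> (\<lambda>K e x. p K e x + \<gamma> e *\<^sub>R (u K x - uh e x)) (\<lambda>K. vh)
      = ip_mesh_bdry \<T> (Phat_load \<T> k \<alpha> \<gamma> f) (\<lambda>K. vh) - ahat \<T> k \<alpha> \<gamma> uh vh" if vh: "vh \<in> Vhat" for vh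
  proof -
    have "ip_bdry K (\<lambda>e x. p K e x + \<gamma> e *\<^sub>R (u K x - uh e x)) vh
        = ip_bdry K (Phat_trace \<T> k \<alpha> \<gamma> uh K) vh + ip_bdry K (Phat_load \<T> k \<alpha> \<gamma> f K) vh" if K: "K \<in> \<T>" for K
    proof -
      note c = V_space_edge_continuous[OF t(1) K] Q_space_edge_continuous[OF t(2) K]
        V_space_edge_continuous[OF l(1) K] Q_space_edge_continuous[OF l(2) K] Vhat_space_edge_continuous[OF _ K]
      have "(\<lambda>e x. p K e x + \<gamma> e *\<^sub>R (u K x - uh e x))
          = (\<lambda>e x. Phat_trace \<T> k \<alpha> \<gamma> uh K e x + Phat_load \<T> k \<alpha> \<gamma> f K e x)"
        by (simp add: up Phat_trace_def Phat_load_def fun_eq_iff algebra_simps)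
      moreover have "edge_continuous K (Phat_trace \<T> k \<alpha> \<gamma> uh K)" "edge_continuous K (Phat_load \<T> k \<alpha> \<gamma> f K)"
        unfolding Phat_trace_def Phat_load_def
        by (rule edge_continuous_add[OF c(2) edge_continuous_scale[OF edge_continuous_diff[OF c(1) c(5)[OF uh]]]],
            rule edge_continuous_add[OF c(4) edge_continuous_scale[OF c(3)]])
      ultimately show ?thesis
        using ip_bdry_add[OF simplex2[OF K] _ _ c(5)[OF vh]] by simp
    qed
    then show ?thesis by (simp add: ip_mesh_bdry_def ahat_def sum.distrib)
  qed
  have "local_problem f uh u p" using local_problem_iff[OF f uh] up by simp
  then show ?thesis
    unfolding hybrid_solution_iff_local condensed_solution_def using uh up flux by auto
next
  case False
  then show ?thesis
    unfolding hybrid_solution_iff_local condensed_solution_def using local_problem_iff[OF f] by blast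
qed

lemma ahat_identity:
  assumes u: "u \<in> Vhat" and v: "v \<in> Vhat"
  shows "ahat \<T> k \<alpha> \<gamma> u v = (\<Sum>K\<in>\<T>. ip_cell K (div2 (U u K)) (div2 (U v K))
     + ip_cell K (curl2 (U u K)) (curl2 (U v K)) + \<alpha> * ip_cell K (U u K) (U v K)
     + ip_bdry K (\<lambda>e x. \<gamma> e *\<^sub>R (U u K x - u e x)) (\<lambda>e x. U v K x - v e x))"
  unfolding ahat_def ip_mesh_bdry_def sum_negf[symmetric]
proof (rule sum.cong[OF refl])
  fix K assume K: "K \<in> \<T>"
  note S = simplex2[OF K]
  note tu = trace_solutionD[OF u] and tv = trace_solutionD[OF v]
  note c = V_space_edge_continuous[OF tu(1) K] V_space_edge_continuous[OF tv(1) K]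
    Vhat_space_edge_continuous[OF u K] Vhat_space_edge_continuous[OF v K]
  \<comment> \<open>The second local equation for \<open>v\<close>, tested with the multiplier
    \<open>P u\<close>, trades the trace \<open>v\<close> for \<open>U v\<close>.\<close>
  have 1: "ip_bdry K (P u K) (\<lambda>e. U v K) = ip_bdry K (P u K) v"
    using tv(4)[OF K tu(2)] by (simp add: b_form_def ip_bdry_commute)
  \<comment> \<open>The first local equation for \<open>u\<close>, tested with \<open>U v\<close>,
    then eliminates the multiplier.\<close>
  have 2: "a_form \<alpha> \<gamma> K (U u) (U v) + ip_bdry K (P u K) (\<lambda>e. U v K) = ip_bdry K (\<lambda>e x. \<gamma> e *\<^sub>R u e x) (\<lambda>e. U v K)"
    using tu(3)[OF K tv(1)] by (simp add: b_form_def)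
  have 3: "ip_bdry K (Phat_trace \<T> k \<alpha> \<gamma> u K) v = ip_bdry K (P u K) v
     + (ip_bdry K (\<lambda>e x. \<gamma> e *\<^sub>R U u K x) v - ip_bdry K (\<lambda>e x. \<gamma> e *\<^sub>R u e x) v)"
    unfolding Phat_trace_def by (rule flux_split[OF tu(1,2) u K c(4)])
  have split: "ip_bdry K (\<lambda>e x. \<gamma> e *\<^sub>R (U u K x - u e x)) w
      = ip_bdry K (\<lambda>e x. \<gamma> e *\<^sub>R U u K x) w - ip_bdry K (\<lambda>e x. \<gamma> e *\<^sub>R u e x) w" if "edge_continuous K w" for w
    unfolding scaleR_diff_right
    by (rule ip_bdry_diff[OF S edge_continuous_scale[OF c(1)] edge_continuous_scale[OF c(3)] that])
  have "ip_bdry K (\<lambda>e x. \<gamma> e *\<^sub>R (U u K x - u e x)) (\<lambda>e x. U v K x - v e x)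
      = ip_bdry K (\<lambda>e x. \<gamma> e *\<^sub>R (U u K x - u e x)) (\<lambda>e. U v K) - ip_bdry K (\<lambda>e x. \<gamma> e *\<^sub>R (U u K x - u e x)) v"
    using ip_bdry_diff[OF S c(2,4) edge_continuous_scale[OF edge_continuous_diff[OF c(1,3)], of \<gamma>]]
    by (simp add: ip_bdry_commute)
  then show "- ip_bdry K (Phat_trace \<T> k \<alpha> \<gamma> u K) v = ip_cell K (div2 (U u K)) (div2 (U v K))
     + ip_cell K (curl2 (U u K)) (curl2 (U v K)) + \<alpha> * ip_cell K (U u K) (U v K)
     + ip_bdry K (\<lambda>e x. \<gamma> e *\<^sub>R (U u K x - u e x)) (\<lambda>e x. U v K x - v e x)"
    using 1 2 3 split[OF c(2)] split[OF c(4)] by (simp add: a_form_def)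
qed

lemma ahat_symmetric: "u \<in> Vhat \<Longrightarrow> v \<in> Vhat \<Longrightarrow> ahat \<T> k \<alpha> \<gamma> u v = ahat \<T> k \<alpha> \<gamma> v u"
  unfolding ahat_identity ip_cell_commute[of _ "div2 (U u _)"] ip_cell_commute[of _ "curl2 (U u _)"]
    ip_cell_commute[of _ "U u _"] ip_bdry_scale_commute[of _ \<gamma> "\<lambda>e x. U u _ x - u e x"] ..

end

section \<open>Divergence- and curl-free piecewise polynomial fields\<close>

definition to_complex :: "plane \<Rightarrow> complex" where
  "to_complex x = Complex (x $ 1) (x $ 2)"

definition of_complex :: "complex \<Rightarrow> plane" where
  "of_complex z = vector [Re z, Im z]"

lemma of_complex_to_complex [simp]: "of_complex (to_complex x) = x" "to_complex (of_complex z) = z"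
  by (simp_all add: to_complex_def of_complex_def plane_eq_iff)

lemma linear_to_complex: "linear to_complex"
  by (rule linearI) (simp_all add: to_complex_def complex_eq_iff)

lemma linear_of_complex: "linear of_complex"
  by (rule linearI) (simp_all add: of_complex_def plane_eq_iff)

lemma inj_to_complex: "inj to_complex"
  by (rule inj_on_inverseI[of _ of_complex]) simp

lemma open_to_complex_image: "open S \<Longrightarrow> open (to_complex ` S)"
proof -
  assume "open S"
  moreover have "to_complex ` S = of_complex -` S" by (auto simp: image_iff) (metis of_complex_to_complex(2))
  moreover have "continuous_on UNIV of_complex"
    using linear_of_complex by (simp add: linear_continuous_on linear_conv_bounded_linear)
  ultimately show ?thesis by (simp add: open_vimage)
qed

lemma interior_triangle_nonempty:
  assumes "2 simplex K"
  shows "interior (K::plane set) \<noteq> {}"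
proof -
  have "rel_interior K \<noteq> {}"
    using rel_interior_eq_empty[OF convex_simplex[OF assms]] assms by auto
  then show ?thesis
    using aff_dim_simplex[OF assms] interior_rel_interior_gen[of K] by simp
qed

text \<open>The divergence- and curl-free conditions are the Cauchy-Riemann equations of \<open>v\<^sub>1 - i v\<^sub>2\<close>.  As
  identities between polynomials they extend from the cell to the whole plane.\<close>

lemma div_curl_free_holomorphic:
  assumes "v \<in> vec_poly_space d K" "interior K \<noteq> {}"
    "\<And>x. x \<in> interior K \<Longrightarrow> div2 v x = 0" "\<And>x. x \<in> interior K \<Longrightarrow> curl2 v x = 0"
  obtains F where "F holomorphic_on UNIV" "\<And>x. x \<in> K \<Longrightarrow> F (to_complex x) = Complex (v x $ 1) (- v x $ 2)"
proof -
  obtain P D where PD: "polynomial_extension K v P D"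
    by (rule vec_poly_space_polynomial_extension[OF assms(1)])
  obtain x0 where x0: "x0 \<in> interior K" using assms(2) by blast
  have div0: "D 1 1 x + D 2 2 x = 0" for x
    by (rule real_polynomial_function_eq_0[where P = "\<lambda>x. D 1 1 x + D 2 2 x", OF _ open_interior x0])
      (auto intro: real_polynomial_function.intros(3) polynomial_extensionD(2)[OF PD]
        simp: polynomial_extension_div_curl(1)[OF PD, symmetric] assms(3))
  have curl0: "D 2 1 x - D 1 2 x = 0" for x
    by (rule real_polynomial_function_eq_0[where P = "\<lambda>x. D 2 1 x - D 1 2 x", OF _ open_interior x0])
      (auto intro: real_polynomial_function_diff polynomial_extensionD(2)[OF PD]
        simp: polynomial_extension_div_curl(2)[OF PD, symmetric] assms(4))
  define F where "F z = of_real (P (of_complex z) $ 1) - \<i> * of_real (P (of_complex z) $ 2)" for z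
  have "(F has_field_derivative Complex (D 1 1 (of_complex z)) (- D 2 1 (of_complex z))) (at z)" for z
  proof -
    define x where "x = of_complex z"
    have lin: "(of_complex has_derivative of_complex) (at z)"
      using linear_of_complex linear_imp_has_derivative by blast
    have comp: "((\<lambda>z. P (of_complex z) $ i) has_derivative (\<lambda>h. Re h * D i 1 x + Im h * D i 2 x)) (at z)" for i
      using has_derivative_compose[OF lin, of "\<lambda>x. P x $ i" "\<lambda>h. \<Sum>j\<in>UNIV. h $ j * D i j x"]
        polynomial_extensionD(3)[OF PD, of i x]
      by (simp add: x_def sum_2) (simp add: of_complex_def)
    have "(F has_derivative (\<lambda>h. of_real (Re h * D 1 1 x + Im h * D 1 2 x)
        - \<i> * of_real (Re h * D 2 1 x + Im h * D 2 2 x))) (at z)"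
      unfolding F_def
      by (intro has_derivative_diff has_derivative_mult_right bounded_linear.has_derivative[OF bounded_linear_of_real] comp)
    moreover have "of_real (Re h * D 1 1 x + Im h * D 1 2 x) - \<i> * of_real (Re h * D 2 1 x + Im h * D 2 2 x)
        = Complex (D 1 1 x) (- D 2 1 x) * h" for h
    proof -
      have "D 2 2 x = - D 1 1 x" "D 1 2 x = D 2 1 x" using div0[of x] curl0[of x] by linarith+
      then show ?thesis by (simp add: complex_eq_iff)
    qed
    ultimately show ?thesis by (simp add: has_field_derivative_def x_def)
  qed
  then have "F holomorphic_on UNIV"
    by (auto simp: holomorphic_on_def field_differentiable_def intro: has_field_derivative_at_within)
  moreover have "F (to_complex x) = Complex (v x $ 1) (- v x $ 2)" if "x \<in> K" for x
    using polynomial_extensionD(4)[OF PD that] by (simp add: F_def complex_eq_iff)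
  ultimately show ?thesis using that by blast
qed

text \<open>The end point of a nondegenerate segment is a limit point of it, which is what the
  identity theorem asks for.\<close>

lemma holomorphic_eq_on_segment:
  assumes "f holomorphic_on UNIV" "g holomorphic_on UNIV" "a \<noteq> b"
    "\<And>x. x \<in> closed_segment a b \<Longrightarrow> f (to_complex x) = g (to_complex x)"
  shows "f = g"
proof
  fix z
  have img: "to_complex ` closed_segment a b = closed_segment (to_complex a) (to_complex b)"
    using closed_segment_linear_image[OF linear_to_complex] by blast
  have "to_complex a \<noteq> to_complex b" using assms(3) inj_to_complex by (simp add: inj_eq)
  then have "closed_segment (to_complex a) (to_complex b) \<noteq> {x}" for x
    by (auto simp: closed_segment_eq_sing)
  then have lim: "to_complex a islimpt closed_segment (to_complex a) (to_complex b)"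
    by (intro connected_imp_perfect) auto
  have "(\<lambda>z. f z - g z) holomorphic_on UNIV" using assms(1,2) by (rule holomorphic_on_diff)
  from analytic_continuation[OF this open_UNIV connected_UNIV subset_UNIV UNIV_I lim _ UNIV_I, of z]
  show "f z = g z" using assms(4) by (force simp: img[symmetric])
qed

section \<open>Adjacency of cells and the boundary of the mesh\<close>

lemma interior_cell_subset:
  assumes "polygonal_domain \<Omega>" "conforming_triangulation \<Omega> \<T>" "K \<in> \<T>"
  shows "interior K \<subseteq> \<Omega>"
proof -
  have "K \<subseteq> closure \<Omega>" using assms(2,3) by (auto simp: conforming_triangulation_def)
  then have "interior K \<subseteq> interior (closure \<Omega>)" by (rule interior_mono)
  then show ?thesis using interior_closure_polygonal_domain[OF assms(1)] by simp
qed

definition mesh_vertices :: "plane set set \<Rightarrow> plane set" where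
  "mesh_vertices \<T> = {x. \<exists>K\<in>\<T>. {x} face_of K}"

lemma finite_mesh_vertices:
  assumes "conforming_triangulation \<Omega> \<T>"
  shows "finite (mesh_vertices \<T>)"
proof -
  have "finite \<T>" and s: "\<And>K. K \<in> \<T> \<Longrightarrow> 2 simplex K"
    using assms by (auto simp: conforming_triangulation_def triangulation_def)
  have "finite {x. {x} face_of K}" if "K \<in> \<T>" for K
  proof (rule finite_imageD)
    show "finite ((\<lambda>x. {x}) ` {x. {x} face_of K})"
      by (rule finite_subset[OF _ finite_polytope_faces[OF simplex_imp_polytope[OF s[OF that]]]]) auto
  qed (simp add: inj_on_def)
  moreover have "mesh_vertices \<T> = (\<Union>K\<in>\<T>. {x. {x} face_of K})" by (auto simp: mesh_vertices_def)
  ultimately show ?thesis using \<open>finite \<T>\<close> by simp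
qed

lemma finite_mesh_edges:
  assumes "conforming_triangulation \<Omega> \<T>"
  shows "finite (mesh_edges \<T>)"
proof -
  have "finite \<T>" and "\<And>K. K \<in> \<T> \<Longrightarrow> 2 simplex K"
    using assms by (auto simp: conforming_triangulation_def triangulation_def)
  moreover have "mesh_edges \<T> = (\<Union>K\<in>\<T>. {e. e edge_of K})" by (auto simp: mesh_edges_def)
  ultimately show ?thesis using finite_edges by auto
qed

text \<open>The intersection is a common face through \<open>x\<close>. Since \<open>x\<close> is
  not a vertex, it is an edge or a whole cell, and a two-dimensional face of a triangle is the
  triangle itself.\<close>

lemma meeting_cells_cases:
  assumes "conforming_triangulation \<Omega> \<T>" "K \<in> \<T>" "K' \<in> \<T>" "x \<in> K" "x \<in> K'" "x \<notin> mesh_vertices \<T>"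
  shows "K = K' \<or> (\<exists>e. e edge_of K \<and> e edge_of K')"
proof -
  have tri: "triangulation \<T>" and s: "2 simplex K" "2 simplex K'"
    using assms(1-3) by (auto simp: conforming_triangulation_def)
  have F: "K \<inter> K' face_of K" "K \<inter> K' face_of K'"
    using tri assms(2,3) unfolding triangulation_def by (blast, metis inf_commute)
  have dim: "aff_dim K = 2" using aff_dim_simplex[OF s(1)] .
  have nv: "\<not> {x} face_of K" "\<not> {x} face_of K'" using assms(2,3,6) by (auto simp: mesh_vertices_def)
  have x: "x \<in> K \<inter> K'" using assms(4,5) by blast
  consider "K \<inter> K' = K" | "K \<inter> K' edge_of K"
    using triangle_face_cases[OF s(1) F(1) x] nv by auto
  then show ?thesis
  proof cases
    case 1
    then have "K face_of K'" "x \<in> K" using F(2) x by auto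
    then show ?thesis using triangle_face_cases[OF s(2), of K x] nv dim by (auto simp: edge_of_def)
  next
    case 2
    then show ?thesis using F(2) by (auto simp: edge_of_def)
  qed
qed

text \<open>Deleting the finitely many vertices does not disconnect the domain, and cells meeting away from
  the vertices share an edge.\<close>

lemma cellwise_constant:
  assumes "polygonal_domain \<Omega>" "conforming_triangulation \<Omega> \<T>"
    "\<And>K K' e. K \<in> \<T> \<Longrightarrow> K' \<in> \<T> \<Longrightarrow> e edge_of K \<Longrightarrow> e edge_of K' \<Longrightarrow> F K = F K'"
    "K0 \<in> \<T>" "K1 \<in> \<T>"
  shows "F K0 = F K1"
proof (rule ccontr)
  assume ne: "F K0 \<noteq> F K1"
  have fin: "finite \<T>" and s: "\<And>K. K \<in> \<T> \<Longrightarrow> 2 simplex K" and un: "\<Union>\<T> = closure \<Omega>"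
    using assms(2) by (auto simp: conforming_triangulation_def triangulation_def)
  define S where "S = \<Omega> - mesh_vertices \<T>"
  \<comment> \<open>\<open>A\<close> and \<open>B\<close> are finite unions of closed cells; if
    \<open>F\<close> took two values they would disconnect \<open>S\<close>.\<close>
  define A where "A = \<Union>{K \<in> \<T>. F K = F K0}"
  define B where "B = \<Union>{K \<in> \<T>. F K \<noteq> F K0}"
  have "connected S"
    unfolding S_def
    by (rule connected_open_diff_countable)
      (use assms(1) finite_mesh_vertices[OF assms(2)] in \<open>auto simp: polygonal_domain_def countable_finite\<close>)
  moreover have "closed A" "closed B"
    unfolding A_def B_def using fin s closed_simplex by (auto intro!: closed_Union)
  moreover have "S \<subseteq> A \<union> B"
  proof
    fix x assume "x \<in> S"
    then have "x \<in> \<Union>\<T>" unfolding un S_def using closure_subset by blast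
    then show "x \<in> A \<union> B" by (auto simp: A_def B_def)
  qed
  moreover have "A \<inter> B \<inter> S = {}"
  proof (rule ccontr)
    assume "A \<inter> B \<inter> S \<noteq> {}"
    then obtain x K K' where "x \<in> K" "x \<in> K'" "K \<in> \<T>" "K' \<in> \<T>" "F K = F K0" "F K' \<noteq> F K0" "x \<notin> mesh_vertices \<T>"
      unfolding A_def B_def S_def by blast
    then show False using meeting_cells_cases[OF assms(2)] assms(3) by metis
  qed
  \<comment> \<open>A nonempty open set is infinite, so the finitely many vertices do not exhaust
    the interior of a cell.\<close>
  moreover have meets: "K \<inter> S \<noteq> {}" if "K \<in> \<T>" for K
  proof -
    have "infinite (interior K)"
      using interior_triangle_nonempty[OF s[OF that]] by (metis finite_imp_not_open open_interior)
    then have "interior K - mesh_vertices \<T> \<noteq> {}"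
      using finite_mesh_vertices[OF assms(2)] by (metis Diff_eq_empty_iff finite_subset)
    then show ?thesis
      using interior_cell_subset[OF assms(1,2) that] interior_subset[of K] by (auto simp: S_def)
  qed
  moreover have "A \<inter> S \<noteq> {}"
  proof -
    have "K0 \<subseteq> A" using assms(4) by (auto simp: A_def)
    then show ?thesis using meets[OF assms(4)] by blast
  qed
  moreover have "B \<inter> S \<noteq> {}"
  proof -
    have "K1 \<subseteq> B" using assms(5) ne by (auto simp: B_def)
    then show ?thesis using meets[OF assms(5)] by blast
  qed
  ultimately show False unfolding connected_closed by blast
qed

text \<open>A frontier point lies in some cell but not in its interior, hence on an edge. If it is
  not an end point, the dichotomy for edges puts the entire edge into the frontier.\<close>

lemma frontier_covered:
  assumes "polygonal_domain \<Omega>" "conforming_triangulation \<Omega> \<T>"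
  shows "frontier \<Omega> \<subseteq> mesh_vertices \<T> \<union> \<Union>(boundary_edges \<Omega> \<T>)"
proof
  fix x assume x: "x \<in> frontier \<Omega>"
  have s: "\<And>K. K \<in> \<T> \<Longrightarrow> 2 simplex K" and un: "\<Union>\<T> = closure \<Omega>"
    using assms(2) by (auto simp: conforming_triangulation_def)
  have nx: "x \<notin> \<Omega>" using x polygonal_domain_disjoint_frontier[OF assms(1)] by blast
  obtain K where K: "K \<in> \<T>" "x \<in> K" using x un by (auto simp: frontier_def)
  have "x \<notin> interior K" using nx interior_cell_subset[OF assms K(1)] by blast
  then obtain e where e: "e edge_of K" "x \<in> e" using triangle_boundary_in_edge[OF s[OF K(1)] K(2)] by blast
  obtain a b where ab: "e = closed_segment a b" "a \<noteq> b" using triangle_edge_vertices[OF s[OF K(1)] e(1)] by blast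
  have em: "e \<in> mesh_edges \<T>" using K e by (auto simp: mesh_edges_def)
  show "x \<in> mesh_vertices \<T> \<union> \<Union>(boundary_edges \<Omega> \<T>)"
  proof (cases "x = a \<or> x = b")
    case True
    have "closed_segment a b face_of K" using e(1) ab(1) by (simp add: edge_of_def)
    then have "a extreme_point_of K" "b extreme_point_of K" by (rule segment_face_of)+
    then have "{x} face_of K" using True by (auto simp: face_of_singleton)
    then have "x \<in> mesh_vertices \<T>" using K(1) unfolding mesh_vertices_def by blast
    then show ?thesis by blast
  next
    case False
    then have "x \<in> open_segment a b" using e(2) ab(1) by (auto simp: open_segment_def)
    then have "open_segment a b \<subseteq> frontier \<Omega>" using edge_point_cases[OF assms em ab(1)] nx by blast
    then have "closure (open_segment a b) \<subseteq> frontier \<Omega>" by (rule closure_minimal) simp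
    then have "e \<subseteq> frontier \<Omega>" using ab by simp
    then show ?thesis using em e(2) by (auto simp: boundary_edges_def)
  qed
qed

text \<open>\<open>Re (g * (b - a))\<close>, read in the complex plane, is the derivative of
  \<open>Re G\<close> along the segment; for g = w_1 - i w_2 it is the inner product of w with
  \<open>b - a\<close>.\<close>

lemma constant_along_segment:
  assumes "\<And>z. (G has_field_derivative g z) (at z)"
    "\<And>x. x \<in> closed_segment a b \<Longrightarrow> Re (g (to_complex x) * to_complex (b - a)) = 0"
  shows "\<exists>c. \<forall>x\<in>closed_segment a b. Re (G (to_complex x)) = c"
proof -
  have tl: "to_complex (linepath a b t) = to_complex a + of_real t * to_complex (b - a)" for t
    by (simp add: linepath_def to_complex_def complex_eq_iff algebra_simps)
  have "((\<lambda>t. Re (G (to_complex (linepath a b t)))) has_derivative (\<lambda>h. 0)) (at t within {0..1})"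
    if t: "t \<in> {0..1}" for t
  proof -
    define z where "z = to_complex (linepath a b t)"
    have "((\<lambda>t. to_complex a + of_real t * to_complex (b - a)) has_derivative (\<lambda>h. of_real h * to_complex (b - a))) (at t within {0..1})"
      by (auto intro!: derivative_eq_intros)
    then have l: "((\<lambda>t. to_complex (linepath a b t)) has_derivative (\<lambda>h. of_real h * to_complex (b - a))) (at t within {0..1})"
      by (simp add: tl)
    have "(G has_derivative (*) (g z)) (at z)" using assms(1) by (simp add: has_field_derivative_def)
    from has_derivative_compose[OF l this[unfolded z_def]]
    have "((\<lambda>t. G (to_complex (linepath a b t))) has_derivative (\<lambda>h. g z * (of_real h * to_complex (b - a)))) (at t within {0..1})"
      by (simp add: z_def)
    from bounded_linear.has_derivative[OF bounded_linear_Re this]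
    have D: "((\<lambda>t. Re (G (to_complex (linepath a b t)))) has_derivative (\<lambda>h. Re (g z * (of_real h * to_complex (b - a))))) (at t within {0..1})" .
    have "linepath a b t \<in> closed_segment a b" using t by (simp add: linepath_in_path)
    then have "Re (g z * to_complex (b - a)) = 0" using assms(2) by (simp add: z_def)
    moreover have "Re (g z * (of_real h * to_complex (b - a))) = h * Re (g z * to_complex (b - a))" for h
      by (simp add: algebra_simps)
    ultimately have "(\<lambda>h. Re (g z * (of_real h * to_complex (b - a)))) = (\<lambda>h. 0)" by (simp only: mult_zero_right)
    then show ?thesis using D by (simp only:)
  qed
  then obtain c where "\<forall>t\<in>{0..1}. Re (G (to_complex (linepath a b t))) = c"
    using has_derivative_zero_constant[of "{0..1::real}"] by blast
  then show ?thesis by (metis linepath_image_01 imageE)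
qed

text \<open>The real differential of \<open>Re G\<close> sends \<open>h\<close> to
  \<open>Re (g * h)\<close>; testing with 1 and \<open>\<i>\<close> determines both parts of
  \<open>g\<close>.\<close>

lemma derivative_eq_0_if_Re_constant:
  assumes "(G has_field_derivative g) (at z)" "open S" "z \<in> S" "\<And>w. w \<in> S \<Longrightarrow> Re (G w) = c"
  shows "g = 0"
proof -
  have D: "((\<lambda>w. Re (G w)) has_derivative (\<lambda>h. Re (g * h))) (at z)"
    using assms(1) unfolding has_field_derivative_def by (rule bounded_linear.has_derivative[OF bounded_linear_Re])
  have "((\<lambda>w. c) has_derivative (\<lambda>h. 0)) (at z)" by simp
  then have "((\<lambda>w. Re (G w)) has_derivative (\<lambda>h. 0)) (at z)"
    by (rule has_derivative_transform_within_open[OF _ assms(2,3)]) (simp add: assms(4))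
  from has_derivative_unique[OF D this] have "Re (g * h) = 0" for h by (rule fun_cong)
  from this[of 1] this[of "\<i>"] show "g = 0" by (simp add: complex_eq_iff)
qed

text \<open>The maximum principle for \<open>G\<close> gives the upper bound, for \<open>- G\<close>
  the lower one.\<close>

lemma Re_constant_if_constant_on_frontier:
  assumes "G holomorphic_on UNIV" "open S" "bounded S" "\<And>z. z \<in> frontier S \<Longrightarrow> Re (G z) = c" "z \<in> S"
  shows "Re (G z) = c"
proof (rule antisym)
  have hol: "G holomorphic_on A" "(\<lambda>z. - G z) holomorphic_on A" for A
    using assms(1) by (auto intro: holomorphic_on_subset holomorphic_on_minus)
  have cont: "continuous_on A G" "continuous_on A (\<lambda>z. - G z)" for A
    using hol by (auto intro: holomorphic_on_imp_continuous_on)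
  show "Re (G z) \<le> c"
    by (rule maximum_real_frontier[OF hol(1) cont(1) assms(3) _ assms(5)]) (simp add: assms(4))
  have "Re (- G z) \<le> - c"
    by (rule maximum_real_frontier[OF hol(2) cont(2) assms(3) _ assms(5)]) (simp add: assms(4))
  then show "c \<le> Re (G z)" by simp
qed

text \<open>Such a field is the gradient of the real part of one entire function; this real part is
  constant on every boundary edge, hence on the connected boundary, hence everywhere.\<close>

theorem piecewise_harmonic_field_eq_0:
  assumes dom: "polygonal_domain \<Omega>" and conf: "conforming_triangulation \<Omega> \<T>" and "connected (- \<Omega>)"
    and poly: "\<And>K. K \<in> \<T> \<Longrightarrow> w K \<in> vec_poly_space d K"
    and div0: "\<And>K x. K \<in> \<T> \<Longrightarrow> x \<in> interior K \<Longrightarrow> div2 (w K) x = 0"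
    and curl0: "\<And>K x. K \<in> \<T> \<Longrightarrow> x \<in> interior K \<Longrightarrow> curl2 (w K) x = 0"
    and trace: "\<And>K K' e x. K \<in> \<T> \<Longrightarrow> K' \<in> \<T> \<Longrightarrow> e edge_of K \<Longrightarrow> e edge_of K' \<Longrightarrow> x \<in> e \<Longrightarrow> w K x = w K' x"
    and tangential: "\<And>K a b x. K \<in> \<T> \<Longrightarrow> closed_segment a b edge_of K \<Longrightarrow> closed_segment a b \<in> boundary_edges \<Omega> \<T> \<Longrightarrow>
       x \<in> closed_segment a b \<Longrightarrow> w K x \<bullet> (b - a) = 0"
    and "K \<in> \<T>" "x \<in> interior K"
  shows "w K x = 0"
proof -
  have s: "\<And>K. K \<in> \<T> \<Longrightarrow> 2 simplex K" using conf by (auto simp: conforming_triangulation_def)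
  have "\<exists>F. F holomorphic_on UNIV \<and> (\<forall>x\<in>K. F (to_complex x) = Complex (w K x $ 1) (- w K x $ 2))" if K: "K \<in> \<T>" for K
    by (rule div_curl_free_holomorphic[OF poly[OF K] interior_triangle_nonempty[OF s[OF K]] div0[OF K] curl0[OF K]]) blast+
  then obtain F where F: "\<And>K. K \<in> \<T> \<Longrightarrow> F K holomorphic_on UNIV"
    "\<And>K x. K \<in> \<T> \<Longrightarrow> x \<in> K \<Longrightarrow> F K (to_complex x) = Complex (w K x $ 1) (- w K x $ 2)"
    using bchoice[of \<T> "\<lambda>K F. F holomorphic_on UNIV \<and> (\<forall>x\<in>K. F (to_complex x) = Complex (w K x $ 1) (- w K x $ 2))"] by blast
  have same: "F K1 = F K2" if K12: "K1 \<in> \<T>" "K2 \<in> \<T>" for K1 K2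
  proof (rule cellwise_constant[OF dom conf _ K12])
    fix K1 K2 e assume K1: "K1 \<in> \<T>" "e edge_of K1" and K2: "K2 \<in> \<T>" "e edge_of K2"
    obtain a b where ab: "e = closed_segment a b" "a \<noteq> b" using triangle_edge_vertices[OF s[OF K1(1)] K1(2)] by blast
    show "F K1 = F K2"
    proof (rule holomorphic_eq_on_segment[OF F(1)[OF K1(1)] F(1)[OF K2(1)] ab(2)])
      fix y assume "y \<in> closed_segment a b"
      then have y: "y \<in> e" using ab by simp
      then have "y \<in> K1" "y \<in> K2" using K1(2) K2(2) edge_of_imp_subset by blast+
      then show "F K1 (to_complex y) = F K2 (to_complex y)"
        using F(2) K1(1) K2(1) trace[OF K1(1) K2(1) K1(2) K2(2) y] by simp
    qed
  qed
  define f where "f = F K"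
  have f: "F L = f" if "L \<in> \<T>" for L using same[OF that assms(9)] by (simp add: f_def)
  obtain G where G: "\<And>z. (G has_field_derivative f z) (at z)"
    using holomorphic_convex_primitive'[OF convex_UNIV open_UNIV, of f] F(1)[OF assms(9)] by (auto simp: f_def)
  have holG: "G holomorphic_on UNIV"
    using G by (auto simp: holomorphic_on_def field_differentiable_def intro: has_field_derivative_at_within)
  define \<phi> where "\<phi> x = Re (G (to_complex x))" for x
  \<comment> \<open>Consecutive boundary edges are never compared: finitely many values on the
    frontier are enough, since a nonempty finite connected set of reals is a point.\<close>
  have "finite (\<phi> ` e)" if e: "e \<in> boundary_edges \<Omega> \<T>" for e
  proof -
    obtain L where L: "L \<in> \<T>" "e edge_of L" using e by (auto simp: boundary_edges_def mesh_edges_def)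
    obtain a b where ab: "e = closed_segment a b" "a \<noteq> b" using triangle_edge_vertices[OF s[OF L(1)] L(2)] by blast
    have "\<exists>c. \<forall>x\<in>closed_segment a b. Re (G (to_complex x)) = c"
    proof (rule constant_along_segment[OF G])
      fix y assume y: "y \<in> closed_segment a b"
      then have "y \<in> L" using L(2) ab(1) edge_of_imp_subset by blast
      then have "f (to_complex y) = Complex (w L y $ 1) (- w L y $ 2)" using F(2)[OF L(1)] f[OF L(1)] by simp
      \<comment> \<open>The minus sign in the second component turns the real part of the complex
        product into the inner product of the plane.\<close>
      then have "Re (f (to_complex y) * to_complex (b - a)) = w L y \<bullet> (b - a)"
        by (simp add: to_complex_def inner_vec_def sum_2)
      then show "Re (f (to_complex y) * to_complex (b - a)) = 0"
        using tangential[OF L(1) _ _ y] L(2) e ab(1) by simp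
    qed
    then obtain c where "\<phi> ` e \<subseteq> {c}" unfolding ab(1) \<phi>_def by blast
    then show ?thesis using finite_subset by blast
  qed
  moreover have "finite (boundary_edges \<Omega> \<T>)"
    using finite_mesh_edges[OF conf] by (simp add: boundary_edges_def)
  moreover have "\<phi> ` frontier \<Omega> \<subseteq> \<phi> ` mesh_vertices \<T> \<union> (\<Union>e\<in>boundary_edges \<Omega> \<T>. \<phi> ` e)"
    using frontier_covered[OF dom conf] by blast
  ultimately have "finite (\<phi> ` frontier \<Omega>)"
    using finite_mesh_vertices[OF conf] by (meson finite_UN_I finite_Un finite_imageI finite_subset)
  moreover have "connected (\<phi> ` frontier \<Omega>)"
  proof (rule connected_continuous_image)
    \<comment> \<open>A connected domain with connected complement has a connected frontier; with
      holes, each boundary component could carry its own constant.\<close>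
    show "connected (frontier \<Omega>)"
      using dom assms(3) by (intro connected_frontier_simple) (auto simp: polygonal_domain_def)
    have "continuous_on UNIV G" using holG by (rule holomorphic_on_imp_continuous_on)
    then have "continuous_on A (\<lambda>x. G (to_complex x))" for A
      by (rule continuous_on_compose2) (auto intro: linear_continuous_on linear_to_complex[unfolded linear_conv_bounded_linear])
    then show "continuous_on (frontier \<Omega>) \<phi>"
      unfolding \<phi>_def by (rule continuous_on_Re)
  qed
  ultimately obtain c where c: "\<And>y. y \<in> frontier \<Omega> \<Longrightarrow> \<phi> y = c"
    using connected_finite_iff_sing[of "\<phi> ` frontier \<Omega>"] by auto
  define S where "S = to_complex ` \<Omega>"
  have S: "open S" "bounded S"
    using dom open_to_complex_image bounded_linear_image[of \<Omega> to_complex] linear_to_complex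
    by (auto simp: S_def polygonal_domain_def linear_conv_bounded_linear)
  have "closure S = to_complex ` closure \<Omega>"
    using closure_injective_linear_image[OF linear_to_complex inj_to_complex] by (simp add: S_def)
  then have fr: "frontier S = to_complex ` frontier \<Omega>"
    using S(1) dom inj_to_complex
    by (simp add: frontier_def interior_open polygonal_domain_def image_set_diff) (simp add: S_def)
  have const: "Re (G z) = c" if "z \<in> S" for z
    by (rule Re_constant_if_constant_on_frontier[OF holG S _ that]) (use c in \<open>auto simp: fr \<phi>_def\<close>)
  have x: "x \<in> \<Omega>" "x \<in> K" using interior_cell_subset[OF dom conf assms(9)] assms(10) interior_subset by blast+
  have "f (to_complex x) = 0"
    by (rule derivative_eq_0_if_Re_constant[OF G S(1) _ const]) (use x in \<open>auto simp: S_def\<close>)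
  then show ?thesis
    using F(2)[OF assms(9) x(2)] by (simp add: f_def complex_eq_iff plane_eq_iff)
qed

section \<open>Positive definiteness\<close>

text \<open>\<open>outer_normal\<close> is a definite description, so a unit normal pointing away
  from the cell has to be exhibited and shown to be unique before anything is known about
  it.\<close>

lemma outer_normal_properties:
  assumes "K = convex hull {a, b, c}" "cross2 (b - a) (c - a) \<noteq> 0" "e = closed_segment a b"
  shows "norm (outer_normal K e) = 1" "outer_normal K e \<bullet> (b - a) = 0"
proof -
  define is_normal where "is_normal n \<longleftrightarrow> norm n = 1 \<and> (\<forall>x\<in>e. \<forall>y\<in>e. n \<bullet> (y - x) = 0) \<and>
    (\<forall>x\<in>e. \<forall>y\<in>K. n \<bullet> (y - x) \<le> 0)" for n :: plane
  \<comment> \<open>The edge vector after a quarter turn, so that its inner product with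
    \<open>y\<close> is \<open>cross2 (b - a) y\<close>.\<close>
  define m :: plane where "m = vector [- (b - a) $ 2, (b - a) $ 1]"
  \<comment> \<open>The sign turns \<open>m\<close> away from the third vertex \<open>c\<close>; the
    quotient normalizes it.\<close>
  define s where "s = - sgn (cross2 (b - a) (c - a)) / norm m"
  have m_inner: "m \<bullet> y = cross2 (b - a) y" for y by (simp add: m_def cross2_def inner_vec_def sum_2 algebra_simps)
  have m0: "m \<noteq> 0" using assms(2) m_inner[of "c - a"] by auto
  have on_e: "n \<bullet> x = n \<bullet> a" if perp: "n \<bullet> (b - a) = 0" and x: "x \<in> e" for n x :: plane
  proof -
    obtain u where u: "x = (1 - u) *\<^sub>R a + u *\<^sub>R b" using x assms(3) by (auto simp: in_segment)
    have "n \<bullet> x = n \<bullet> a + u * (n \<bullet> (b - a))" unfolding u by (simp add: inner_add_right inner_diff_right algebra_simps)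
    then show ?thesis using perp by simp
  qed
  have ab: "a \<in> e" "b \<in> e" "c \<in> K"
    using assms(1,3) hull_inc[of c "{a, b, c}" convex] by auto
  have ex: "is_normal (s *\<^sub>R m)"
    unfolding is_normal_def
  proof (intro conjI ballI)
    show "norm (s *\<^sub>R m) = 1" using m0 assms(2) by (simp add: s_def abs_sgn_eq)
    have perp: "(s *\<^sub>R m) \<bullet> (b - a) = 0" by (simp add: m_inner) (simp add: cross2_def)
    show "(s *\<^sub>R m) \<bullet> (y - x) = 0" if "x \<in> e" "y \<in> e" for x y
      using on_e[OF perp that(1)] on_e[OF perp that(2)] unfolding inner_diff_right by linarith
    have "K \<subseteq> {y. (s *\<^sub>R m) \<bullet> y \<le> (s *\<^sub>R m) \<bullet> a}"
      unfolding assms(1)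
    proof (rule hull_minimal)
      have "(s *\<^sub>R m) \<bullet> (c - a) \<le> 0"
      proof -
        have "(s *\<^sub>R m) \<bullet> (c - a) = - (sgn (cross2 (b - a) (c - a)) * cross2 (b - a) (c - a)) / norm m"
          by (simp add: m_inner s_def)
        also have "\<dots> = - \<bar>cross2 (b - a) (c - a)\<bar> / norm m" by (simp add: abs_sgn mult.commute)
        finally show ?thesis by simp
      qed
      then have "(s *\<^sub>R m) \<bullet> c \<le> (s *\<^sub>R m) \<bullet> a" unfolding inner_diff_right by linarith
      moreover have "(s *\<^sub>R m) \<bullet> b = (s *\<^sub>R m) \<bullet> a" using perp unfolding inner_diff_right by linarith
      ultimately show "{a, b, c} \<subseteq> {y. (s *\<^sub>R m) \<bullet> y \<le> (s *\<^sub>R m) \<bullet> a}"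
        unfolding insert_subset mem_Collect_eq by (intro conjI empty_subsetI) linarith+
    qed (rule convex_halfspace_le)
    then show "(s *\<^sub>R m) \<bullet> (y - x) \<le> 0" if "x \<in> e" "y \<in> K" for x y
      using on_e[OF perp that(1)] subsetD[OF _ that(2)] unfolding inner_diff_right by fastforce
  qed
  \<comment> \<open>Both normals are multiples of \<open>m\<close> of equal length; nonpositivity
    towards the vertex \<open>c\<close> fixes the common sign.\<close>
  have uniq: "n = n'" if n: "is_normal n" and n': "is_normal n'" for n n'
  proof -
    have p: "n \<bullet> (b - a) = 0" "n' \<bullet> (b - a) = 0" and le: "n \<bullet> (c - a) \<le> 0" "n' \<bullet> (c - a) \<le> 0"
      and nm: "norm n = 1" "norm n' = 1"
      using n n' ab unfolding is_normal_def by blast+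
    have par: "\<exists>t. n = t *\<^sub>R m" if "n \<bullet> (b - a) = 0" for n
    proof -
      have "cross2 m n = 0" using that by (simp add: m_def cross2_def inner_vec_def sum_2 algebra_simps)
      then show ?thesis by (rule cross2_eq_0_imp_parallel[OF _ m0]) blast
    qed
    obtain t t' where t: "n = t *\<^sub>R m" "n' = t' *\<^sub>R m" using par p by blast
    have "\<bar>t\<bar> * norm m = \<bar>t'\<bar> * norm m" using nm t by simp
    then have "\<bar>t\<bar> = \<bar>t'\<bar>" using m0 by simp
    moreover have "t * cross2 (b - a) (c - a) \<le> 0" "t' * cross2 (b - a) (c - a) \<le> 0"
      using le by (simp_all add: t m_inner)
    ultimately have "t = t'"
      using assms(2) by (auto simp: abs_if mult_le_0_iff split: if_splits)
    then show ?thesis by (simp add: t)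
  qed
  have "is_normal (THE n. is_normal n)" by (rule theI[of is_normal, OF ex uniq[OF _ ex]])
  then have on: "is_normal (outer_normal K e)"
    by (simp add: outer_normal_def is_normal_def)
  then show "norm (outer_normal K e) = 1" "outer_normal K e \<bullet> (b - a) = 0"
    using ab unfolding is_normal_def by blast+
qed

lemma parallel_to_normal_imp_orthogonal_to_edge:
  assumes "2 simplex K" "closed_segment a b edge_of K" "cross2 v (outer_normal K (closed_segment a b)) = 0"
  shows "v \<bullet> (b - a) = 0"
proof -
  obtain c where c: "K = convex hull {a, b, c}" "cross2 (b - a) (c - a) \<noteq> 0"
    using edge_vertices[OF assms(1,2) refl] by blast
  define n where "n = outer_normal K (closed_segment a b)"
  have n: "norm n = 1" "n \<bullet> (b - a) = 0"
    using outer_normal_properties[OF c refl] by (simp_all add: n_def)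
  have "cross2 n v = 0" using assms(3) by (simp add: n_def cross2_def algebra_simps)
  moreover have "n \<noteq> 0" using n(1) by auto
  ultimately obtain t where "v = t *\<^sub>R n" by (rule cross2_eq_0_imp_parallel)
  then show ?thesis using n(2) by simp
qed

text \<open>The interior is dense in a triangle, and the field is continuous up to the
  boundary.\<close>

lemma vec_poly_space_eq_0_on_cell:
  assumes "2 simplex K" "v \<in> vec_poly_space d K" "\<And>x. x \<in> interior K \<Longrightarrow> v x = 0" "x \<in> K"
  shows "v x = 0"
proof -
  have cl: "closure (interior K) = K"
    using convex_closure_interior[OF convex_simplex[OF assms(1)] interior_triangle_nonempty[OF assms(1)]]
      closed_simplex[OF assms(1)] by simp
  have "continuous_on (closure (interior K)) v"
    unfolding cl by (rule vec_poly_space_continuous_on[OF assms(2) subset_refl])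
  then show ?thesis
    by (rule continuous_constant_on_closure) (use assms(3,4) cl in auto)
qed

context hybridized_method
begin

text \<open>Equality of edge fields means agreement at every point: on an edge it comes from the
  cell field, off the edge and off the mesh from extension by zero.\<close>

lemma Vhat_eq_0_if_solution_0:
  assumes v: "v \<in> Vhat"
    and trace: "\<And>K e x. K \<in> \<T> \<Longrightarrow> e edge_of K \<Longrightarrow> x \<in> e \<Longrightarrow> U v K x = v e x"
    and zero: "\<And>K x. K \<in> \<T> \<Longrightarrow> x \<in> interior K \<Longrightarrow> U v K x = 0"
  shows "v = (\<lambda>e x. 0)"
proof (intro ext)
  fix e x
  show "v e x = 0"
  proof (cases "e \<in> mesh_edges \<T>")
    case True
    then obtain K where K: "K \<in> \<T>" "e edge_of K" by (auto simp: mesh_edges_def)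
    show ?thesis
    proof (cases "x \<in> e")
      case True
      then have "x \<in> K" using K(2) edge_of_imp_subset by blast
      then have "U v K x = 0"
        using vec_poly_space_eq_0_on_cell[OF simplex2[OF K(1)] V_spaceD[OF trace_solutionD(1)[OF v] K(1)] zero[OF K(1)]]
        by blast
      then show ?thesis using trace[OF K True] by simp
    qed (rule vec_poly_space_outside[OF Vhat_spaceD[OF v K]])
  next
    case False
    then show ?thesis using v by (simp add: Vhat_space_def)
  qed
qed

text \<open>The inequality is the negation of strict positivity. The terms of the energy identity
  are nonnegative, so each vanishes on each cell, and the vanishing integrals then become pointwise
  statements.\<close>

lemma ahat_nonpos_imp_terms_0:
  assumes v: "v \<in> Vhat" and "0 \<le> \<alpha>" and pos: "\<And>e. e \<in> mesh_edges \<T> \<Longrightarrow> 0 < \<gamma> e"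
    and le: "ahat \<T> k \<alpha> \<gamma> v v \<le> 0" and K: "K \<in> \<T>"
  shows "x \<in> interior K \<Longrightarrow> div2 (U v K) x = 0" "x \<in> interior K \<Longrightarrow> curl2 (U v K) x = 0"
    "0 < \<alpha> \<Longrightarrow> x \<in> interior K \<Longrightarrow> U v K x = 0"
    "e edge_of K \<Longrightarrow> x \<in> e \<Longrightarrow> U v K x = v e x"
proof -
  define d where "d L = ip_cell L (div2 (U v L)) (div2 (U v L))" for L
  define c where "c L = ip_cell L (curl2 (U v L)) (curl2 (U v L))" for L
  define m where "m L = \<alpha> * ip_cell L (U v L) (U v L)" for L
  define j where "j L = ip_bdry L (\<lambda>e x. \<gamma> e *\<^sub>R (U v L x - v e x)) (\<lambda>e x. U v L x - v e x)" for L
  have ec: "edge_continuous L (\<lambda>e x. U v L x - v e x)" if "L \<in> \<T>" for L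
    using edge_continuous_diff[OF V_space_edge_continuous[OF trace_solutionD(1)[OF v] that] Vhat_space_edge_continuous[OF v that]] .
  have \<gamma>: "0 < \<gamma> e" if "L \<in> \<T>" "e edge_of L" for L e
    using that by (intro pos) (auto simp: mesh_edges_def)
  have nonneg: "0 \<le> d L" "0 \<le> c L" "0 \<le> m L" "0 \<le> j L" if "L \<in> \<T>" for L
    unfolding d_def c_def m_def j_def
    using ip_bdry_scale_self_nonneg[OF simplex2[OF that] ec[OF that] less_imp_le[OF \<gamma>[OF that]]]
    by (simp_all add: ip_cell_nonneg assms(2))
  have "(\<Sum>L\<in>\<T>. d L + c L + m L + j L) \<le> 0"
    using le unfolding ahat_identity[OF v v] d_def c_def m_def j_def .
  then have "(\<Sum>L\<in>\<T>. d L + c L + m L + j L) = 0"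
    by (rule antisym) (intro sum_nonneg add_nonneg_nonneg nonneg)
  then have "d K + c K + m K + j K = 0"
    using sum_nonneg_eq_0_iff[OF finite_mesh, of "\<lambda>L. d L + c L + m L + j L"] nonneg K
    by (simp add: add_nonneg_nonneg)
  then have terms: "d K = 0" "c K = 0" "m K = 0" "j K = 0"
    using nonneg[OF K] by linarith+
  note S = simplex2[OF K]
  note cc = convex_simplex[OF S] compact_simplex[OF S]
  note ic = interior_continuous_vec_poly[OF V_spaceD[OF trace_solutionD(1)[OF v] K]]
  show "div2 (U v K) x = 0" if "x \<in> interior K"
    using ip_cell_self_eq_0[OF cc ic(2) _ that] terms(1) by (simp add: d_def)
  show "curl2 (U v K) x = 0" if "x \<in> interior K"
    using ip_cell_self_eq_0[OF cc ic(3) _ that] terms(2) by (simp add: c_def)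
  show "U v K x = 0" if "0 < \<alpha>" "x \<in> interior K"
    using ip_cell_self_eq_0[OF cc ic(1) _ that(2)] terms(3) that(1) by (simp add: m_def)
  show "U v K x = v e x" if "e edge_of K" "x \<in> e"
    using ip_bdry_scale_self_eq_0[OF S ec[OF K] \<gamma>[OF K] _ that] terms(4) by (simp add: j_def)
qed

lemma ahat_positive_definite:
  assumes dom: "polygonal_domain \<Omega>" and pos: "\<And>e. e \<in> mesh_edges \<T> \<Longrightarrow> 0 < \<gamma> e"
    and \<alpha>: "0 < \<alpha> \<or> \<alpha> = 0 \<and> connected (- \<Omega>)"
  shows "symmetric_positive_definite_on Vhat (ahat \<T> k \<alpha> \<gamma>)"
  unfolding symmetric_positive_definite_on_def
proof (intro conjI ballI impI)
  fix v w assume "v \<in> Vhat" "w \<in> Vhat"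
  then show "ahat \<T> k \<alpha> \<gamma> v w = ahat \<T> k \<alpha> \<gamma> w v" by (rule ahat_symmetric)
next
  fix v assume v: "v \<in> Vhat" and ne: "v \<noteq> (\<lambda>e x. 0)"
  show "0 < ahat \<T> k \<alpha> \<gamma> v v"
  proof (rule ccontr)
    assume "\<not> 0 < ahat \<T> k \<alpha> \<gamma> v v"
    then have le: "ahat \<T> k \<alpha> \<gamma> v v \<le> 0" by simp
    have "0 \<le> \<alpha>" using \<alpha> by auto
    note terms = ahat_nonpos_imp_terms_0[OF v this pos le]
    have "U v K x = 0" if K: "K \<in> \<T>" "x \<in> interior K" for K x
    proof (cases "0 < \<alpha>")
      case True
      then show ?thesis using terms(3)[OF _ K(1) _ K(2)] by blast
    next
      case False
      then have conn: "connected (- \<Omega>)" using \<alpha> by simp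
      show ?thesis
      proof (rule piecewise_harmonic_field_eq_0[OF dom conforming conn, where w = "U v"])
        show "U v K \<in> vec_poly_space (2 * k - 1) K" if "K \<in> \<T>" for K
          using V_spaceD[OF trace_solutionD(1)[OF v] that] .
        show "div2 (U v K) x = 0" "curl2 (U v K) x = 0" if "K \<in> \<T>" "x \<in> interior K" for K x
          using terms(1,2)[OF _ that] by blast+
        \<comment> \<open>Both sides equal the single-valued trace \<open>v\<close> on the common
          edge.\<close>
        show "U v K x = U v K' x" if "K \<in> \<T>" "K' \<in> \<T>" "e edge_of K" "e edge_of K'" "x \<in> e" for K K' e x
          using terms(4)[OF _ that(1,3,5)] terms(4)[OF _ that(2,4,5)] by simp
        show "U v K x \<bullet> (b - a) = 0"
          if "K \<in> \<T>" "closed_segment a b edge_of K" "closed_segment a b \<in> boundary_edges \<Omega> \<T>" "x \<in> closed_segment a b" for K a b x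
        proof -
          \<comment> \<open>The boundary condition is imposed on \<open>v\<close>; it passes to
            \<open>U v\<close> because the two agree on the edge.\<close>
          have "cross2 (v (closed_segment a b) x) (outer_normal K (closed_segment a b)) = 0"
            using v that unfolding Vhat_space_def by blast
          then have "cross2 (U v K x) (outer_normal K (closed_segment a b)) = 0"
            using terms(4)[OF _ that(1,2,4)] by simp
          then show ?thesis
            by (rule parallel_to_normal_imp_orthogonal_to_edge[OF simplex2[OF that(1)] that(2)])
        qed
      qed (rule K)+
    qed
    then have "v = (\<lambda>e x. 0)"
      using Vhat_eq_0_if_solution_0[OF v] terms(4) by blast
    then show False using ne by contradiction
  qed
qed

end

text \<open>Two components are functions of the third, so passing to the trace is a bijection
  between the solution sets.\<close>

lemma ex1_iff_if_determined:
  assumes "\<And>u p z. H (u, p, z) \<longleftrightarrow> C z \<and> u = A z \<and> p = B z"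
  shows "(\<exists>!s. H s) \<longleftrightarrow> (\<exists>!z. C z)"
proof -
  have "H s \<longleftrightarrow> (\<exists>z. C z \<and> s = (A z, B z, z))" for s
    using assms[of "fst s" "fst (snd s)" "snd (snd s)"] by (cases s) auto
  then show ?thesis by auto
qed

theorem theorem2p9:
  fixes \<Omega> :: "(real^2) set" and f :: "real^2 \<Rightarrow> real^2" and \<alpha> :: real
    and \<T> :: "(real^2) set set" and k :: nat and \<mu> :: "real^2 \<Rightarrow> real"
  assumes "polygonal_domain \<Omega>"
    and "f \<in> L2_fields \<Omega>"
    and "conforming_triangulation \<Omega> \<T>"
    and "k \<ge> 1"
    and "admissible_exponents \<Omega> \<mu>"
    and "local_solvers_well_defined \<Omega> \<T> k \<alpha> (penalty \<Omega> \<mu>)"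
  shows "(\<forall>u p uh.
            hybrid_solution \<Omega> \<T> k \<alpha> (penalty \<Omega> \<mu>) f (u, p, uh) \<longleftrightarrow>
              condensed_solution \<Omega> \<T> k \<alpha> (penalty \<Omega> \<mu>) f uh \<and>
              u = (\<lambda>K x. U_trace \<T> k \<alpha> (penalty \<Omega> \<mu>) uh K x + U_load \<T> k \<alpha> (penalty \<Omega> \<mu>) f K x) \<and>
              p = (\<lambda>K e x. P_trace \<T> k \<alpha> (penalty \<Omega> \<mu>) uh K e x + P_load \<T> k \<alpha> (penalty \<Omega> \<mu>) f K e x))
       \<and> ((\<exists>!s. hybrid_solution \<Omega> \<T> k \<alpha> (penalty \<Omega> \<mu>) f s) \<longleftrightarrow>
          (\<exists>!uh. condensed_solution \<Omega> \<T> k \<alpha> (penalty \<Omega> \<mu>) f uh))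
       \<and> (\<alpha> > 0 \<longrightarrow>
          symmetric_positive_definite_on (Vhat_space \<Omega> \<T> k) (ahat \<T> k \<alpha> (penalty \<Omega> \<mu>)))
       \<and> (\<alpha> = 0 \<and> connected (- \<Omega>) \<longrightarrow>
          symmetric_positive_definite_on (Vhat_space \<Omega> \<T> k) (ahat \<T> k \<alpha> (penalty \<Omega> \<mu>)))"
proof -
  interpret hybridized_method \<Omega> \<T> k \<alpha> "penalty \<Omega> \<mu>"
    by unfold_locales (use assms in auto)
  note equivalence = hybrid_solution_iff_condensed[OF assms(2)]
  note definite = ahat_positive_definite[OF assms(1) penalty_pos[OF assms(1,3)]]
  show ?thesis
    using equivalence ex1_iff_if_determined[OF equivalence] definite by blast
qed

end
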